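(* For the network data of the context, suppose that the nominal network $[\![P,TH]\!]$ is stable; that linear $S=\bigoplus_{i\in\mathcal V}S_i:\mathbf L_{2e}^n\to\mathbf L_{2e}^n$ and linear $S^\dagger=\bigoplus_{i\in\mathcal V}S_i^\dagger:\mathbf D\subset\mathbf L_{2e}^n\to\mathbf L_{2e}^n$ are fixed such that $\varDelta:=(\varLambda-I_{2m})\circ TS$ and $G:=S^\dagger H(P-TH)^{-1}$ are stable and $\varDelta\circ G=(\varLambda-I_{2m})\circ TH(P-TH)^{-1}$; and that for each $i\in\mathcal V$, $H_i=N_iD_i^{-1}$ with $N_i:\mathbf L_{2e}^{m_i}\to\mathbf L_{2e}$ and $D_i:\mathbf L_{2e}^{m_i}\to\mathbf L_{2e}^{m_i}$ stable linear systems satisfying $U_iN_i+V_iD_i=I_{m_i}$ for some stable linear systems $U_i:\mathbf L_{2e}\to\mathbf L_{2e}^{m_i}$, $V_i:\mathbf L_{2e}^{m_i}\to\mathbf L_{2e}^{m_i}$. Let $\varPi_1,\varPi_2,\varPi_3$ be the block-diagonal multiplier components of the context, and let $$N:=\bigoplus_{i\in\mathcal V}S_i^\dagger N_i,\qquad M:=P\Big(\bigoplus_{i\in\mathcal V}D_i\Big)-\bigoplus_{i\in\mathcal V}(\mathbf 1_{m_i,1}N_i).$$ Then the following two conditions are equivalent: (i) there exists $\epsilon\in\mathbb R_{>0}$ such that for all $u\in\mathbf L_2^{2m}$, with $y=Gu$, $$\left\langle\begin{bmatrix}y\\ u\end{bmatrix},\begin{bmatrix}\varPi_1&\varPi_2\\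 \varPi_2^*&\varPi_3\end{bmatrix}\begin{bmatrix}y\\ u\end{bmatrix}\right\rangle\le-\epsilon\|u\|^2;$$ (ii) there exists $\epsilon\in\mathbb R_{>0}$ such that for all $z\in\mathbf L_2^{2m}$, $$\left\langle\begin{bmatrix}N\\ M\end{bmatrix}z,\begin{bmatrix}\varPi_1&\varPi_2\\ \varPi_2^*&\varPi_3\end{bmatrix}\begin{bmatrix}N\\ M\end{bmatrix}z\right\rangle\le-\epsilon\|z\|^2.$$
   Context: **Signals and systems.** $[j]=\{1,\dots,j\}$ (empty if $j=0$). $\mathbf L_2^r$ is the Hilbert space of finite-energy signals $v:\mathbb R_{\ge0}\to\mathbb R^r$, with $\langle v,u\rangle=\int_0^\infty v(t)'u(t)\,dt$; $\mathbf L_{2e}^r$ is the extended space of $v$ with $\boldsymbol\pi_\tau(v)\in\mathbf L_2^r$ for all $\tau\ge0$, where $(\boldsymbol\pi_\tau v)(t)=v(t)$ for $t<\tau$ and $0$ otherwise. A map $G:\mathbf L_{2e}^q\to\mathbf L_{2e}^r$ is a system if it is causal ($\boldsymbol\pi_\tau(G(u))=\boldsymbol\pi_\tau(G(\boldsymbol\pi_\tau u))$ for all $\tau$) and $G(0)=0$; a system is stable if moreover there is $c>0$ with $\|G(u)\|\le c\|u\|$ for all $u\in\mathbf L_2^q$. Matrices denote pointwise multiplication; $\bigoplus$ denotes block-diagonal direct sum; ${}^*$ is the Hilbert adjoint (on $\mathbf L_2$) of a bounded linear map. The feedback interconnection of $G:\mathbf L_{2e}^q\to\mathbf L_{2e}^r$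 and $\varDelta:\mathbf L_{2e}^r\to\mathbf L_{2e}^q$ is well-posed if for all $(d_y,d_u)$ there is a unique $(y,u)\in\mathbf L_{2e}^r\times\mathbf L_{2e}^q$ with $y=G(u)+d_y$, $u=\varDelta(y)+d_u$, and $[\![G,\varDelta]\!]:(d_y,d_u)\mapsto(y,u)$ is causal; $[\![G,\varDelta]\!]$ is stable if it is well-posed and this map is a stable system. $\mathbf 1_{r,q}$ is the all-ones matrix. **Graph.** $\mathscr G=(\mathcal V,\mathscr E)$ is a simple connected undirected graph, $\mathcal V=[n]$, $n\ge2$, $m=|\mathscr E|$. For $i\in\mathcal V$: $\mathcal N_i$ is the set of neighbours, $m_i=|\mathcal N_i|$, $\mathcal M_i=[m_i]$. Bijections $\kappa_i:\mathcal N_i\to\mathcal M_i$ are fixed. Put $s_i=\sum_{h\in[i-1]}m_h$. The permutation matrix $P\in\mathbb R^{2m\times2m}$ has, for $i\in\mathcal V$, $k\in\mathcal M_i$, $r=s_i+k$: $P_{(r,q)}=1$ if $q=s_j+\kappa_j(i)$ with $j=\kappa_i^{-1}(k)$, and $P_{(r,q)}=0$ otherwise. **Network model.** For each $i$, agent $H_i:\mathbf L_{2e}^{m_i}\to\mathbf L_{2e}$ is linear and causal (possibly unbounded); links $\varLambda_{i,k}:\mathbf L_{2e}\to\mathbf L_{2e}$, $k\in\mathcal M_i$, are causal (possibly nonlinear and time-varying). $\varLambda=\bigoplus_{i\in\mathcal V}\bigoplus_{k\in\mathcal M_i}\varLambda_{i,k}$, $T=\bigoplus_{i\in\mathcal V}\mathbf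 1_{m_i,1}:\mathbf L_{2e}^n\to\mathbf L_{2e}^{2m}$, $H=\bigoplus_{i\in\mathcal V}H_i:\mathbf L_{2e}^{2m}\to\mathbf L_{2e}^n$. The maps $S_i$, $S_i^\dagger$, $N_i$, $D_i$ are those fixed in the claim. **Multiplier.** With $\varDelta_i=(\bigoplus_{k\in\mathcal M_i}\varLambda_{i,k}-I_{m_i})\circ\mathbf 1_{m_i,1}S_i$, bounded linear self-adjoint $\bar\varPi_i=\begin{bmatrix}\varPi_{1,i}&\varPi_{2,i}\\ \varPi_{2,i}^*&\varPi_{3,i}\end{bmatrix}$ on $\mathbf L_2\times\mathbf L_2^{m_i}$ are given with $\langle(y_i,u_i),\bar\varPi_i(y_i,u_i)\rangle\ge0$ for all $y_i\in\mathbf L_2$, $\alpha\in[0,1]$, $u_i=\alpha\varDelta_i(y_i)$. Set $\varPi_\bullet=\bigoplus_{i\in\mathcal V}\varPi_{\bullet,i}$, $\bullet\in\{1,2,3\}$. *)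

theory Defs
  imports "HOL-Analysis.Analysis" "HOL-Library.Function_Algebras"
begin

abbreviation time_measure :: "real measure" where
  "time_measure \<equiv> lebesgue_on {0..}"

definition finite_energy :: "(real \<Rightarrow> real) \<Rightarrow> bool" where
  "finite_energy f \<longleftrightarrow>
     f \<in> borel_measurable time_measure \<and> integrable time_measure (\<lambda>t. (f t)\<^sup>2)"

definition cut :: "real \<Rightarrow> (real \<Rightarrow> real) \<Rightarrow> real \<Rightarrow> real" where
  "cut \<tau> f = (\<lambda>t. if t < \<tau> then f t else 0)"

definition locally_finite_energy :: "(real \<Rightarrow> real) \<Rightarrow> bool" where
  "locally_finite_energy f \<longleftrightarrow> (\<forall>\<tau>\<ge>0. finite_energy (cut \<tau> f))"

definition sig_rel :: "(real \<Rightarrow> real) \<Rightarrow> (real \<Rightarrow> real) \<Rightarrow> bool" where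
  "sig_rel f g \<longleftrightarrow> locally_finite_energy f \<and> locally_finite_energy g \<and>
     (AE t in time_measure. f t = g t)"

lemma finite_energy_zero: "finite_energy (\<lambda>_. 0)"
  by (simp add: finite_energy_def)

lemma finite_energy_add:
  assumes f: "finite_energy f" and g: "finite_energy g"
  shows "finite_energy (\<lambda>t. f t + g t)"
proof -
  have m [measurable]: "f \<in> borel_measurable time_measure" "g \<in> borel_measurable time_measure"
    using f g by (auto simp: finite_energy_def)
  have "integrable time_measure (\<lambda>t. (f t + g t)\<^sup>2)"
  proof (rule Bochner_Integration.integrable_bound)
    show "integrable time_measure (\<lambda>t. 2 * (f t)\<^sup>2 + 2 * (g t)\<^sup>2)"
      using f g by (auto simp: finite_energy_def)
    have "(f t + g t)\<^sup>2 \<le> 2 * (f t)\<^sup>2 + 2 * (g t)\<^sup>2" for t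
      using sum_squares_bound[of "f t" "g t"] by (simp add: power2_sum)
    then show "AE t in time_measure.
        norm ((f t + g t)\<^sup>2) \<le> norm (2 * (f t)\<^sup>2 + 2 * (g t)\<^sup>2)"
      by simp
  qed measurable
  then show ?thesis
    by (simp add: finite_energy_def)
qed

lemma finite_energy_scale:
  "finite_energy f \<Longrightarrow> finite_energy (\<lambda>t. a * f t)"
  by (auto simp: finite_energy_def power_mult_distrib)

lemma cut_add: "cut \<tau> (\<lambda>t. f t + g t) = (\<lambda>t. cut \<tau> f t + cut \<tau> g t)"
  by (auto simp: cut_def)

lemma cut_scale: "cut \<tau> (\<lambda>t. a * f t) = (\<lambda>t. a * cut \<tau> f t)"
  by (auto simp: cut_def)

lemma cut_cut: "cut \<sigma> (cut \<tau> f) = cut (min \<sigma> \<tau>) f"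
  by (auto simp: cut_def)

lemma locally_finite_energy_zero: "locally_finite_energy (\<lambda>_. 0)"
  by (simp add: locally_finite_energy_def cut_def finite_energy_zero)

lemma locally_finite_energy_add:
  "locally_finite_energy f \<Longrightarrow> locally_finite_energy g \<Longrightarrow>
     locally_finite_energy (\<lambda>t. f t + g t)"
  by (simp add: locally_finite_energy_def cut_add finite_energy_add)

lemma locally_finite_energy_scale:
  "locally_finite_energy f \<Longrightarrow> locally_finite_energy (\<lambda>t. a * f t)"
  by (simp add: locally_finite_energy_def cut_scale finite_energy_scale)

lemma finite_energy_cong_AE:
  assumes "f \<in> borel_measurable time_measure" "g \<in> borel_measurable time_measure"
    and "AE t in time_measure. f t = g t"
  shows "finite_energy f \<longleftrightarrow> finite_energy g"
proof -
  have "integrable time_measure (\<lambda>t. (f t)\<^sup>2) \<longleftrightarrow> integrable time_measure (\<lambda>t. (g t)\<^sup>2)"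
    using assms by (intro integrable_cong_AE) auto
  then show ?thesis
    using assms by (simp add: finite_energy_def)
qed

lemma finite_energy_cut_neg: "\<tau> < 0 \<Longrightarrow> finite_energy (cut \<tau> f)"
proof -
  assume \<tau>: "\<tau> < 0"
  have "finite_energy (cut \<tau> f) \<longleftrightarrow> finite_energy (\<lambda>_. 0)"
    unfolding finite_energy_def using \<tau>
    by (intro conj_cong measurable_cong Bochner_Integration.integrable_cong)
       (auto simp: cut_def)
  then show ?thesis
    by (simp add: finite_energy_zero)
qed

lemma locally_finite_energy_cut:
  assumes "locally_finite_energy f" shows "locally_finite_energy (cut \<tau> f)"
  unfolding locally_finite_energy_def cut_cut
proof (intro allI impI)
  fix \<sigma> :: real
  show "finite_energy (cut (min \<sigma> \<tau>) f)"
    using assms finite_energy_cut_neg[of "min \<sigma> \<tau>" f]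
    by (cases "0 \<le> min \<sigma> \<tau>") (simp_all add: locally_finite_energy_def)
qed

lemma locally_finite_energy_measurable:
  assumes "locally_finite_energy f"
  shows "f \<in> borel_measurable time_measure"
proof (rule borel_measurable_LIMSEQ_real)
  fix t :: real
  have "\<forall>\<^sub>F n in sequentially. cut (real n) f t = f t"
    using eventually_gt_at_top[of "nat \<lceil>t\<rceil>"]
    by eventually_elim (simp add: cut_def, linarith)
  then show "(\<lambda>n. cut (real n) f t) \<longlonglongrightarrow> f t"
    by (rule tendsto_eventually)
next
  fix n :: nat
  show "cut (real n) f \<in> borel_measurable time_measure"
    using assms by (auto simp: locally_finite_energy_def finite_energy_def)
qed

lemma sig_rel_part_equivp: "part_equivp sig_rel"
proof (rule part_equivpI)
  show "\<exists>f. sig_rel f f"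
    by (rule exI[of _ "\<lambda>_. 0"]) (simp add: sig_rel_def locally_finite_energy_zero)
  show "symp sig_rel"
    by (rule sympI) (auto simp: sig_rel_def)
  show "transp sig_rel"
    by (rule transpI) (auto simp: sig_rel_def)
qed

text \<open>
  The elements of \<open>sig\<close> are the scalar signals with locally finite energy, identified when they
  agree almost everywhere on the half-line.
\<close>

quotient_type sig = "real \<Rightarrow> real" / partial: sig_rel
  by (rule sig_rel_part_equivp)

instantiation sig :: real_vector
begin

lift_definition zero_sig :: sig is "\<lambda>_. 0"
  by (simp add: sig_rel_def locally_finite_energy_zero)

lift_definition plus_sig :: "sig \<Rightarrow> sig \<Rightarrow> sig" is "\<lambda>f g t. f t + g t"
  by (auto simp: sig_rel_def locally_finite_energy_add)

lift_definition scaleR_sig :: "real \<Rightarrow> sig \<Rightarrow> sig" is "\<lambda>a f t. a * f t"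
  by (auto simp: sig_rel_def locally_finite_energy_scale)

definition uminus_sig :: "sig \<Rightarrow> sig" where
  "uminus_sig x = (-1) *\<^sub>R x"

definition minus_sig :: "sig \<Rightarrow> sig \<Rightarrow> sig" where
  "minus_sig x y = x + (- y)"

instance
proof
  fix a b c :: sig and r s :: real
  show "a + b + c = a + (b + c)"
    by transfer (auto simp: sig_rel_def locally_finite_energy_add add.assoc)
  show "a + b = b + a"
    by transfer (auto simp: sig_rel_def locally_finite_energy_add add.commute)
  show "0 + a = a"
    by transfer (auto simp: sig_rel_def)
  show "- a + a = 0"
    unfolding uminus_sig_def
    by transfer (auto simp: sig_rel_def locally_finite_energy_zero
        intro!: locally_finite_energy_add locally_finite_energy_scale[where a = "-1", simplified])
  show "a - b = a + - b"
    by (simp add: minus_sig_def)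
  show "r *\<^sub>R (a + b) = r *\<^sub>R a + r *\<^sub>R b"
    by transfer (auto simp: sig_rel_def distrib_left
        intro!: locally_finite_energy_add locally_finite_energy_scale)
  show "(r + s) *\<^sub>R a = r *\<^sub>R a + s *\<^sub>R a"
    by transfer (auto simp: sig_rel_def distrib_right
        intro!: locally_finite_energy_add locally_finite_energy_scale)
  show "r *\<^sub>R s *\<^sub>R a = (r * s) *\<^sub>R a"
    by transfer (auto simp: sig_rel_def mult.assoc
        intro!: locally_finite_energy_scale)
  show "1 *\<^sub>R a = a"
    by transfer (auto simp: sig_rel_def)
qed

end

lift_definition sig_trunc :: "real \<Rightarrow> sig \<Rightarrow> sig" is cut
  by (auto simp: sig_rel_def locally_finite_energy_cut) (auto simp: cut_def elim: eventually_mono)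

lift_definition sig_L2 :: "sig \<Rightarrow> bool" is finite_energy
  using finite_energy_cong_AE locally_finite_energy_measurable
  by (auto simp: sig_rel_def)

lift_definition sig_inner :: "sig \<Rightarrow> sig \<Rightarrow> real"
  is "\<lambda>f g. integral\<^sup>L time_measure (\<lambda>t. f t * g t)"
  by (intro integral_cong_AE)
     (auto simp: sig_rel_def
       intro!: borel_measurable_times dest: locally_finite_energy_measurable elim: eventually_elim2)

text \<open>
  A signal with values in \<open>\<real>\<^sup>r\<close> is the family of its components, indexed by \<open>1, \<dots>, r\<close> and
  extended by \<open>0\<close>.  In this way signals of all dimensions live in one type, and a scalar signal
  is a vector signal of dimension \<open>1\<close>.
\<close>

type_synonym vsig = "nat \<Rightarrow> sig"

instantiation "fun" :: (type, real_vector) real_vector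
begin

definition scaleR_fun :: "real \<Rightarrow> ('a \<Rightarrow> 'b) \<Rightarrow> 'a \<Rightarrow> 'b" where
  "scaleR_fun a f = (\<lambda>x. a *\<^sub>R f x)"

instance
  by standard (auto simp: scaleR_fun_def scaleR_add_left scaleR_add_right)

end

definition L2e :: "nat \<Rightarrow> vsig set" where
  "L2e r = {v. \<forall>k. k \<notin> {1..r} \<longrightarrow> v k = 0}"

definition L2 :: "nat \<Rightarrow> vsig set" where
  "L2 r = {v \<in> L2e r. \<forall>k\<in>{1..r}. sig_L2 (v k)}"

definition trunc :: "real \<Rightarrow> vsig \<Rightarrow> vsig" where
  "trunc \<tau> v = (\<lambda>k. sig_trunc \<tau> (v k))"

text \<open>The values of \<open>inner_L2 r\<close> and \<open>norm_L2 r\<close> are meaningful on \<open>L2 r\<close> only.\<close>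

definition inner_L2 :: "nat \<Rightarrow> vsig \<Rightarrow> vsig \<Rightarrow> real" where
  "inner_L2 r v u = (\<Sum>k=1..r. sig_inner (v k) (u k))"

definition norm_L2 :: "nat \<Rightarrow> vsig \<Rightarrow> real" where
  "norm_L2 r v = sqrt (inner_L2 r v v)"

definition shift_in :: "nat \<Rightarrow> nat \<Rightarrow> vsig \<Rightarrow> vsig" where
  "shift_in s r w = (\<lambda>k. if k \<in> {s+1..s+r} then w (k - s) else 0)"

definition block :: "nat \<Rightarrow> nat \<Rightarrow> vsig \<Rightarrow> vsig" where
  "block s r v = (\<lambda>k. if k \<in> {1..r} then v (s + k) else 0)"

text \<open>\<open>stack r q y u\<close> is the column \<open>(y, u)\<close>; it identifies \<open>L2e r \<times> L2e q\<close> with \<open>L2e (r + q)\<close>.\<close>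

definition stack :: "nat \<Rightarrow> nat \<Rightarrow> vsig \<Rightarrow> vsig \<Rightarrow> vsig" where
  "stack r q y u = shift_in 0 r y + shift_in r q u"

definition linear_map :: "nat \<Rightarrow> nat \<Rightarrow> (vsig \<Rightarrow> vsig) \<Rightarrow> bool" where
  "linear_map q r F \<longleftrightarrow> F \<in> L2e q \<rightarrow> L2e r \<and>
     (\<forall>u\<in>L2e q. \<forall>v\<in>L2e q. F (u + v) = F u + F v) \<and>
     (\<forall>a. \<forall>u\<in>L2e q. F (a *\<^sub>R u) = a *\<^sub>R F u)"

definition partial_linear_map :: "nat \<Rightarrow> nat \<Rightarrow> vsig set \<Rightarrow> (vsig \<Rightarrow> vsig) \<Rightarrow> bool" where
  "partial_linear_map q r X F \<longleftrightarrow> subspace X \<and> X \<subseteq> L2e q \<and> F \<in> X \<rightarrow> L2e r \<and>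
     (\<forall>u\<in>X. \<forall>v\<in>X. F (u + v) = F u + F v) \<and>
     (\<forall>a. \<forall>u\<in>X. F (a *\<^sub>R u) = a *\<^sub>R F u)"

definition causal :: "nat \<Rightarrow> nat \<Rightarrow> (vsig \<Rightarrow> vsig) \<Rightarrow> bool" where
  "causal q r F \<longleftrightarrow> F \<in> L2e q \<rightarrow> L2e r \<and>
     (\<forall>\<tau>\<ge>0. \<forall>u\<in>L2e q. trunc \<tau> (F u) = trunc \<tau> (F (trunc \<tau> u)))"

definition system :: "nat \<Rightarrow> nat \<Rightarrow> (vsig \<Rightarrow> vsig) \<Rightarrow> bool" where
  "system q r F \<longleftrightarrow> causal q r F \<and> F 0 = 0"

definition stable_system :: "nat \<Rightarrow> nat \<Rightarrow> (vsig \<Rightarrow> vsig) \<Rightarrow> bool" where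
  "stable_system q r F \<longleftrightarrow> system q r F \<and>
     (\<exists>c>0. \<forall>u\<in>L2 q. F u \<in> L2 r \<and> norm_L2 r (F u) \<le> c * norm_L2 q u)"

definition mat_map :: "nat \<Rightarrow> nat \<Rightarrow> (nat \<Rightarrow> nat \<Rightarrow> real) \<Rightarrow> vsig \<Rightarrow> vsig" where
  "mat_map r q A v = (\<lambda>k. if k \<in> {1..r} then (\<Sum>j=1..q. A k j *\<^sub>R v j) else 0)"

definition ones :: "nat \<Rightarrow> nat \<Rightarrow> vsig \<Rightarrow> vsig" where
  "ones r q = mat_map r q (\<lambda>_ _. 1)"

definition offset :: "(nat \<Rightarrow> nat) \<Rightarrow> nat \<Rightarrow> nat" where
  "offset d i = (\<Sum>h=1..<i. d h)"

text \<open>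
  \<open>direct_sum n q r F\<close> is the block-diagonal direct sum of the maps \<open>F i\<close> from dimension \<open>q i\<close> to
  dimension \<open>r i\<close>, for \<open>i = 1, \<dots>, n\<close>.
\<close>

definition direct_sum :: "nat \<Rightarrow> (nat \<Rightarrow> nat) \<Rightarrow> (nat \<Rightarrow> nat) \<Rightarrow> (nat \<Rightarrow> vsig \<Rightarrow> vsig) \<Rightarrow> vsig \<Rightarrow> vsig" where
  "direct_sum n q r F v = (\<Sum>i=1..n. shift_in (offset r i) (r i) (F i (block (offset q i) (q i) v)))"

definition fb_solution ::
    "nat \<Rightarrow> nat \<Rightarrow> (vsig \<Rightarrow> vsig) \<Rightarrow> (vsig \<Rightarrow> vsig) \<Rightarrow> vsig \<Rightarrow> vsig \<Rightarrow> vsig \<times> vsig \<Rightarrow> bool" where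
  "fb_solution q r G \<Delta> dy du = (\<lambda>(y, u). y \<in> L2e r \<and> u \<in> L2e q \<and> y = G u + dy \<and> u = \<Delta> y + du)"

text \<open>
  The closed-loop map of \<open>G\<close> (from dimension \<open>q\<close> to \<open>r\<close>) and \<open>\<Delta>\<close> (from dimension \<open>r\<close> to \<open>q\<close>),
  acting on and returning stacked pairs.
\<close>

definition fb_map :: "nat \<Rightarrow> nat \<Rightarrow> (vsig \<Rightarrow> vsig) \<Rightarrow> (vsig \<Rightarrow> vsig) \<Rightarrow> vsig \<Rightarrow> vsig" where
  "fb_map q r G \<Delta> d =
     (case (THE p. fb_solution q r G \<Delta> (block 0 r d) (block r q d) p) of (y, u) \<Rightarrow> stack r q y u)"

definition well_posed :: "nat \<Rightarrow> nat \<Rightarrow> (vsig \<Rightarrow> vsig) \<Rightarrow> (vsig \<Rightarrow> vsig) \<Rightarrow> bool" where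
  "well_posed q r G \<Delta> \<longleftrightarrow>
     (\<forall>dy\<in>L2e r. \<forall>du\<in>L2e q. \<exists>!p. fb_solution q r G \<Delta> dy du p) \<and>
     causal (r + q) (r + q) (fb_map q r G \<Delta>)"

definition fb_stable :: "nat \<Rightarrow> nat \<Rightarrow> (vsig \<Rightarrow> vsig) \<Rightarrow> (vsig \<Rightarrow> vsig) \<Rightarrow> bool" where
  "fb_stable q r G \<Delta> \<longleftrightarrow> well_posed q r G \<Delta> \<and> stable_system (r + q) (r + q) (fb_map q r G \<Delta>)"

definition bounded_linear_L2 :: "nat \<Rightarrow> nat \<Rightarrow> (vsig \<Rightarrow> vsig) \<Rightarrow> bool" where
  "bounded_linear_L2 q r A \<longleftrightarrow> A \<in> L2 q \<rightarrow> L2 r \<and>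
     (\<forall>u\<in>L2 q. \<forall>v\<in>L2 q. A (u + v) = A u + A v) \<and>
     (\<forall>a. \<forall>u\<in>L2 q. A (a *\<^sub>R u) = a *\<^sub>R A u) \<and>
     (\<exists>c. \<forall>u\<in>L2 q. norm_L2 r (A u) \<le> c * norm_L2 q u)"

text \<open>
  The Hilbert adjoint of a bounded linear \<open>A\<close> from \<open>L2 q\<close> to \<open>L2 r\<close>: by the Riesz representation
  theorem the representer below exists and is unique for every \<open>w \<in> L2 r\<close>.
\<close>

definition adj :: "nat \<Rightarrow> nat \<Rightarrow> (vsig \<Rightarrow> vsig) \<Rightarrow> vsig \<Rightarrow> vsig" where
  "adj q r A w = (THE v. v \<in> L2 q \<and> (\<forall>x\<in>L2 q. inner_L2 r (A x) w = inner_L2 q x v))"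

definition self_adjoint_L2 :: "nat \<Rightarrow> (vsig \<Rightarrow> vsig) \<Rightarrow> bool" where
  "self_adjoint_L2 r A \<longleftrightarrow> (\<forall>x\<in>L2 r. \<forall>y\<in>L2 r. inner_L2 r (A x) y = inner_L2 r x (A y))"

text \<open>
  The operator with block rows \<open>(\<Pi>1, \<Pi>2)\<close> and \<open>(\<Pi>2\<^sup>*, \<Pi>3)\<close> on \<open>L2 p \<times> L2 q\<close>, acting on stacked
  pairs; here \<open>\<Pi>2\<close> maps \<open>L2 q\<close> to \<open>L2 p\<close>.
\<close>

definition multiplier ::
    "nat \<Rightarrow> nat \<Rightarrow> (vsig \<Rightarrow> vsig) \<Rightarrow> (vsig \<Rightarrow> vsig) \<Rightarrow> (vsig \<Rightarrow> vsig) \<Rightarrow> vsig \<Rightarrow> vsig" where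
  "multiplier p q \<Pi>1 \<Pi>2 \<Pi>3 v =
     (let y = block 0 p v; u = block p q v
      in stack p q (\<Pi>1 y + \<Pi>2 u) (adj q p \<Pi>2 y + \<Pi>3 u))"

definition quad_form ::
    "nat \<Rightarrow> nat \<Rightarrow> (vsig \<Rightarrow> vsig) \<Rightarrow> (vsig \<Rightarrow> vsig) \<Rightarrow> (vsig \<Rightarrow> vsig) \<Rightarrow> vsig \<Rightarrow> vsig \<Rightarrow> real" where
  "quad_form p q \<Pi>1 \<Pi>2 \<Pi>3 y u =
     inner_L2 (p + q) (stack p q y u) (multiplier p q \<Pi>1 \<Pi>2 \<Pi>3 (stack p q y u))"

definition simple_graph :: "nat \<Rightarrow> nat set set \<Rightarrow> bool" where
  "simple_graph n E \<longleftrightarrow> E \<subseteq> {e. e \<subseteq> {1..n} \<and> card e = 2}"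

definition connected_graph :: "nat \<Rightarrow> nat set set \<Rightarrow> bool" where
  "connected_graph n E \<longleftrightarrow> (\<forall>i\<in>{1..n}. \<forall>j\<in>{1..n}. (i, j) \<in> {(a, b). {a, b} \<in> E}\<^sup>*)"

definition nbrs :: "nat set set \<Rightarrow> nat \<Rightarrow> nat set" where
  "nbrs E i = {j. {i, j} \<in> E}"

definition deg :: "nat set set \<Rightarrow> nat \<Rightarrow> nat" where
  "deg E i = card (nbrs E i)"

definition perm_matrix :: "nat \<Rightarrow> nat set set \<Rightarrow> (nat \<Rightarrow> nat \<Rightarrow> nat) \<Rightarrow> nat \<Rightarrow> nat \<Rightarrow> real" where
  "perm_matrix n E \<kappa> r q =
     (if \<exists>i\<in>{1..n}. \<exists>k\<in>{1..deg E i}. r = offset (deg E) i + k \<and>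
           (let j = inv_into (nbrs E i) (\<kappa> i) k in q = offset (deg E) j + \<kappa> j i)
      then 1 else 0)"

end

theory Submission
  imports Defs
begin

text \<open>
  Write \<open>D\<close> and \<open>N\<^sub>0\<close> for the direct sums of the \<open>D\<^sub>i\<close> and the \<open>N\<^sub>i\<close>.  Then \<open>M = (P - TH) D\<close>, so
  that \<open>u = M z\<close> and \<open>z = R u\<close> with \<open>R = D\<inverse> (P - TH)\<inverse>\<close> are inverse to each other and satisfy
  \<open>G u = N z\<close>.  The two quadratic forms therefore agree, and it only remains to see that \<open>M\<close> and
  \<open>R\<close> are both bounded on \<open>L2\<close>.  For \<open>R\<close>, put \<open>w = (P - TH)\<inverse> u\<close>, which is bounded by nominal
  stability.  Then \<open>TH w = P w - u\<close> is bounded as well, hence so is \<open>H w\<close>, because every vertex of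
  a connected graph with at least two vertices has a neighbour; finally
  \<open>z = U N\<^sub>0 z + V D z = U H w + V w\<close>.
\<close>

section \<open>Offsets and block-diagonal direct sums\<close>

lemma offset_1: "offset d (Suc 0) = 0"
  by (simp add: offset_def)

lemma offset_Suc: "i \<ge> 1 \<Longrightarrow> offset d (Suc i) = offset d i + d i"
  by (simp add: offset_def)

lemma offset_mono: "i \<le> j \<Longrightarrow> offset d i \<le> offset d j"
  unfolding offset_def by (rule sum_mono2) auto

text \<open>\<open>offset d i\<close> adds the sizes of the blocks before block \<open>i\<close>, so
  \<open>n\<close> blocks together have dimension \<open>offset d (Suc n)\<close>. The induction
  peels off the last block.\<close>

lemma sum_offset:
  fixes f :: "nat \<Rightarrow> 'a::comm_monoid_add"
  shows "(\<Sum>k=1..offset d (Suc n). f k) = (\<Sum>i=1..n. \<Sum>k=1..d i. f (offset d i + k))"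
proof (induction n)
  case 0
  then show ?case by (simp add: offset_1)
next
  case (Suc n)
  let ?s = "offset d (Suc n)"
  have "(\<Sum>k=1..offset d (Suc (Suc n)). f k) = (\<Sum>k=1..?s + d (Suc n). f k)"
    by (simp add: offset_Suc)
  also have "\<dots> = (\<Sum>k=1..?s. f k) + (\<Sum>k=?s+1..?s + d (Suc n). f k)"
    by (rule sum.ub_add_nat) simp
  also have "(\<Sum>k=?s+1..?s + d (Suc n). f k) = (\<Sum>k=1..d (Suc n). f (?s + k))"
    using sum.shift_bounds_cl_nat_ivl[of f 1 ?s "d (Suc n)"] by (simp add: add.commute)
  finally show ?case using Suc.IH by simp
qed

lemma offset_decompose:
  "r \<in> {1..offset d (Suc n)} \<Longrightarrow> \<exists>i\<in>{1..n}. \<exists>k\<in>{1..d i}. r = offset d i + k"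
proof (induction n)
  case 0
  then show ?case by (simp add: offset_1)
next
  case (Suc n)
  show ?case
  proof (cases "r \<le> offset d (Suc n)")
    case True
    then obtain i where i: "i \<in> {1..n}" "\<exists>k\<in>{1..d i}. r = offset d i + k"
      using Suc by auto
    then have "i \<in> {1..Suc n}" by simp
    with i show ?thesis by blast
  next
    case False
    then have "r - offset d (Suc n) \<in> {1..d (Suc n)}" "r = offset d (Suc n) + (r - offset d (Suc n))"
      using Suc.prems by (auto simp: offset_Suc[of "Suc n"])
    then show ?thesis by force
  qed
qed

lemma offset_add_le:
  assumes "i < j" "1 \<le> i" shows "offset d i + d i \<le> offset d j"
  using offset_mono[of "Suc i" j d] assms by (simp add: offset_Suc)

lemma offset_add_le_total:
  "i \<in> {1..n} \<Longrightarrow> k \<in> {1..d i} \<Longrightarrow> offset d i + k \<in> {1..offset d (Suc n)}"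
  using offset_add_le[of i "Suc n" d] by auto

text \<open>Together with \<open>offset_decompose\<close> this makes the pairs \<open>(i, k)\<close>
  coordinates on the stacked index range. If \<open>i < j\<close>, block \<open>i\<close> ends no
  later than \<open>offset d j\<close>, whereas \<open>l \<ge> 1\<close> puts the other index beyond
  it.\<close>

lemma offset_unique:
  assumes "1 \<le> i" "1 \<le> j" "k \<in> {1..d i}" "l \<in> {1..d j}" "offset d i + k = offset d j + l"
  shows "i = j \<and> k = l"
  using offset_add_le[of i j d] offset_add_le[of j i d] assms
  by (cases i j rule: linorder_cases) auto

lemma block_in_L2e: "block s r v \<in> L2e r"
  by (auto simp: block_def L2e_def)

lemma shift_in_eq_0: "k \<notin> {s+1..s+r} \<Longrightarrow> shift_in s r w k = 0"
  by (simp only: shift_in_def if_False)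

lemma sum_fun_apply: "(\<Sum>i\<in>A. f i) x = (\<Sum>i\<in>A. f i x)"
  by (induction A rule: infinite_finite_induct) auto

text \<open>\<open>shift_in\<close> vanishes outside its block, whatever \<open>F i\<close> produces
  there, and every block ends by \<open>offset r (Suc n)\<close>.\<close>

lemma direct_sum_in_L2e: "direct_sum n q r F v \<in> L2e (offset r (Suc n))"
proof -
  have "shift_in (offset r i) (r i) w k = 0" if "i \<in> {1..n}" "k \<notin> {1..offset r (Suc n)}" for i k w
    using that offset_add_le[of i "Suc n" r] by (intro shift_in_eq_0) auto
  then show ?thesis
    by (simp add: L2e_def direct_sum_def sum_fun_apply)
qed

lemma block_direct_sum:
  assumes i: "i \<in> {1..n}" and F: "F i (block (offset q i) (q i) v) \<in> L2e (r i)"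
  shows "block (offset r i) (r i) (direct_sum n q r F v) = F i (block (offset q i) (q i) v)"
proof
  fix k
  let ?w = "\<lambda>j. F j (block (offset q j) (q j) v)"
  show "block (offset r i) (r i) (direct_sum n q r F v) k = ?w i k"
  proof (cases "k \<in> {1..r i}")
    case True
    \<comment> \<open>Distinct blocks occupy disjoint index ranges, so only summand \<open>i\<close>
      contributes at position \<open>offset r i + k\<close>.\<close>
    have other: "shift_in (offset r j) (r j) (?w j) (offset r i + k) = 0"
      if j: "j \<in> {1..n} - {i}" for j
    proof (rule shift_in_eq_0)
      show "offset r i + k \<notin> {offset r j + 1..offset r j + r j}"
        using offset_unique[of i j k r "offset r i + k - offset r j"] i j True by auto
    qed
    have "direct_sum n q r F v (offset r i + k)
        = shift_in (offset r i) (r i) (?w i) (offset r i + k)"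
      unfolding direct_sum_def sum_fun_apply
      using sum.remove[OF _ i, of "\<lambda>j. shift_in (offset r j) (r j) (?w j) (offset r i + k)"] other
      by simp
    with True show ?thesis by (simp add: block_def shift_in_def)
  next
    case False
    then have "block (offset r i) (r i) (direct_sum n q r F v) k = 0"
      by (simp only: block_def if_False)
    \<comment> \<open>Outside \<open>{1..r i}\<close> the left side is cut off by
      \<open>block\<close>, and the right side vanishes by the range hypothesis on
      \<open>F i\<close>.\<close>
    moreover have "?w i k = 0"
      using F False unfolding L2e_def by blast
    ultimately show ?thesis by simp
  qed
qed

text \<open>The input partitions \<open>q\<close>, \<open>q'\<close> and the arguments
  \<open>v\<close>, \<open>v'\<close> may differ. This makes composition a special case, where one
  argument is itself a direct sum.\<close>

lemma direct_sum_cong: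
  assumes "\<And>i. i \<in> {1..n} \<Longrightarrow>
      F i (block (offset q i) (q i) v) = F' i (block (offset q' i) (q' i) v')"
  shows "direct_sum n q r F v = direct_sum n q' r F' v'"
  unfolding direct_sum_def using assms by (intro sum.cong refl arg_cong) auto

text \<open>The range condition on \<open>K i\<close> ensures that cutting the intermediate signal
  into blocks recovers exactly the outputs of the \<open>K i\<close>.\<close>

lemma direct_sum_comp:
  assumes "\<And>i. i \<in> {1..n} \<Longrightarrow> K i \<in> L2e (p i) \<rightarrow> L2e (q i)"
  shows "direct_sum n q r F (direct_sum n p q K v) = direct_sum n p r (\<lambda>i. F i \<circ> K i) v"
  using assms by (intro direct_sum_cong) (simp add: block_direct_sum Pi_iff block_in_L2e)

lemma direct_sum_id:
  assumes v: "v \<in> L2e (offset d (Suc n))"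
    and F: "\<And>i w. i \<in> {1..n} \<Longrightarrow> w \<in> L2e (d i) \<Longrightarrow> F i w = w"
  shows "direct_sum n d d F v = v"
proof
  fix r
  show "direct_sum n d d F v r = v r"
  proof (cases "r \<in> {1..offset d (Suc n)}")
    case True
    then obtain i k where ik: "i \<in> {1..n}" "k \<in> {1..d i}" "r = offset d i + k"
      using offset_decompose by blast
    then have "block (offset d i) (d i) (direct_sum n d d F v) k = block (offset d i) (d i) v k"
      by (simp add: block_direct_sum F block_in_L2e)
    with ik show ?thesis by (simp add: block_def)
  next
    case False
    with v direct_sum_in_L2e[of n d d F v] show ?thesis by (simp add: L2e_def)
  qed
qed

lemma L2_blocks:
  assumes "v \<in> L2e (offset d (Suc n))"
    and "\<And>i. i \<in> {1..n} \<Longrightarrow> block (offset d i) (d i) v \<in> L2 (d i)"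
  shows "v \<in> L2 (offset d (Suc n))"
proof -
  have "sig_L2 (v r)" if r: "r \<in> {1..offset d (Suc n)}" for r
  proof -
    obtain i k where ik: "i \<in> {1..n}" "k \<in> {1..d i}" "r = offset d i + k"
      using offset_decompose[OF r] by blast
    with assms(2)[of i] have "sig_L2 (block (offset d i) (d i) v k)"
      by (auto simp: L2_def)
    with ik show ?thesis by (simp add: block_def)
  qed
  with assms(1) show ?thesis by (simp add: L2_def)
qed

lemma block_in_L2:
  assumes "v \<in> L2 (offset d (Suc n))" "i \<in> {1..n}"
  shows "block (offset d i) (d i) v \<in> L2 (d i)"
  using assms offset_add_le_total[of i n _ d] by (auto simp: L2_def block_in_L2e) (simp add: block_def)

section \<open>Energy estimates and maps bounded in energy\<close>

abbreviation energy :: "nat \<Rightarrow> vsig \<Rightarrow> real" where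
  "energy r v \<equiv> inner_L2 r v v"

text \<open>This covers signals of infinite energy too: the integral of a non-integrable function is
  0 by default.\<close>

lemma sig_inner_self_nonneg: "0 \<le> sig_inner a a"
  by transfer (simp add: integral_nonneg)

lemma energy_nonneg: "0 \<le> energy r v"
  by (simp add: inner_L2_def sum_nonneg sig_inner_self_nonneg)

lemma norm_L2_sq: "(norm_L2 r v)\<^sup>2 = energy r v"
  by (simp add: norm_L2_def energy_nonneg)

lemma energy_blocks:
  "energy (offset d (Suc n)) v = (\<Sum>i=1..n. energy (d i) (block (offset d i) (d i) v))"
  unfolding inner_L2_def sum_offset[of _ d n]
  by (intro sum.cong refl) (simp add: block_def)

lemma sig_L2_add: "sig_L2 a \<Longrightarrow> sig_L2 b \<Longrightarrow> sig_L2 (a + b)"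
  by transfer (rule finite_energy_add)

lemma sig_L2_scale: "sig_L2 a \<Longrightarrow> sig_L2 (c *\<^sub>R a)"
  by transfer (rule finite_energy_scale)

lemma sig_L2_zero: "sig_L2 0"
  by transfer (rule finite_energy_zero)

text \<open>A substitute for the triangle inequality: pointwise \<open>2 * f t * g t\<close> is at
  most the sum of the two squares, so Cauchy-Schwarz is avoided. The price is the factor 2, harmless
  when only boundedness matters.\<close>

lemma sig_inner_add_le:
  assumes "sig_L2 a" "sig_L2 b"
  shows "sig_inner (a + b) (a + b) \<le> 2 * sig_inner a a + 2 * sig_inner b b"
  using assms
proof transfer
  fix f g assume f: "finite_energy f" and g: "finite_energy g"
  have "integral\<^sup>L time_measure (\<lambda>t. (f t + g t) * (f t + g t))
      \<le> integral\<^sup>L time_measure (\<lambda>t. 2 * (f t * f t) + 2 * (g t * g t))"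
  proof (rule integral_mono)
    show "integrable time_measure (\<lambda>t. (f t + g t) * (f t + g t))"
      using finite_energy_add[OF f g] by (simp add: finite_energy_def power2_eq_square)
    show "integrable time_measure (\<lambda>t. 2 * (f t * f t) + 2 * (g t * g t))"
      using f g by (simp add: finite_energy_def power2_eq_square)
    show "(f t + g t) * (f t + g t) \<le> 2 * (f t * f t) + 2 * (g t * g t)" for t
      using sum_squares_bound[of "f t" "g t"] by (simp add: algebra_simps power2_eq_square)
  qed
  also have "\<dots> = 2 * integral\<^sup>L time_measure (\<lambda>t. f t * f t)
      + 2 * integral\<^sup>L time_measure (\<lambda>t. g t * g t)"
    using f g by (simp add: finite_energy_def power2_eq_square)
  finally show "integral\<^sup>L time_measure (\<lambda>t. (f t + g t) * (f t + g t))
      \<le> 2 * integral\<^sup>L time_measure (\<lambda>t. f t * f t)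
        + 2 * integral\<^sup>L time_measure (\<lambda>t. g t * g t)" .
qed

lemma sig_inner_minus: "sig_inner (- a) (- a) = sig_inner a a"
  unfolding uminus_sig_def by transfer simp

lemma L2_in_L2e: "v \<in> L2 r \<Longrightarrow> v \<in> L2e r"
  by (simp add: L2_def)

lemma L2_add: "v \<in> L2 r \<Longrightarrow> w \<in> L2 r \<Longrightarrow> v + w \<in> L2 r"
  by (auto simp: L2_def L2e_def sig_L2_add)

lemma L2_minus: "v \<in> L2 r \<Longrightarrow> - v \<in> L2 r"
  using sig_L2_scale[of _ "-1"] by (auto simp: L2_def L2e_def)

lemma energy_add_le:
  assumes "v \<in> L2 r" "w \<in> L2 r"
  shows "energy r (v + w) \<le> 2 * energy r v + 2 * energy r w"
proof -
  have "energy r (v + w)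
      \<le> (\<Sum>k=1..r. 2 * sig_inner (v k) (v k) + 2 * sig_inner (w k) (w k))"
    unfolding inner_L2_def using assms
    by (intro sum_mono) (auto simp: L2_def intro!: sig_inner_add_le)
  then show ?thesis
    by (simp add: inner_L2_def sum.distrib sum_distrib_left)
qed

text \<open>The gain condition of \<open>stable_system\<close>, squared and separated from
  causality. Squares are convenient because energies add over blocks; leaving out causality lets the
  notion apply directly to inverse maps.\<close>

definition energy_bounded :: "nat \<Rightarrow> nat \<Rightarrow> (vsig \<Rightarrow> vsig) \<Rightarrow> bool" where
  "energy_bounded q r F \<longleftrightarrow>
     (\<exists>C>0. \<forall>v\<in>L2 q. F v \<in> L2 r \<and> energy r (F v) \<le> C * energy q v)"

lemma stable_system_energy_bounded:
  assumes "stable_system q r F" shows "energy_bounded q r F"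
proof -
  obtain c where c: "c > 0" "\<And>u. u \<in> L2 q \<Longrightarrow> F u \<in> L2 r \<and> norm_L2 r (F u) \<le> c * norm_L2 q u"
    using assms by (auto simp: stable_system_def)
  have "energy r (F u) \<le> c\<^sup>2 * energy q u" if "u \<in> L2 q" for u
  proof -
    have "(norm_L2 r (F u))\<^sup>2 \<le> (c * norm_L2 q u)\<^sup>2"
      using c(2)[OF that] by (intro power_mono) (auto simp: norm_L2_def energy_nonneg)
    then show ?thesis by (simp add: power_mult_distrib norm_L2_sq)
  qed
  with c show ?thesis
    unfolding energy_bounded_def by (intro exI[of _ "c\<^sup>2"]) auto
qed

lemma energy_bounded_comp:
  assumes "energy_bounded q r F" "energy_bounded p q K"
  shows "energy_bounded p r (F \<circ> K)"
proof -
  obtain a where a: "a > 0" "\<And>u. u \<in> L2 q \<Longrightarrow> F u \<in> L2 r \<and> energy r (F u) \<le> a * energy q u"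
    using assms by (auto simp: energy_bounded_def)
  obtain b where b: "b > 0" "\<And>u. u \<in> L2 p \<Longrightarrow> K u \<in> L2 q \<and> energy q (K u) \<le> b * energy p u"
    using assms by (auto simp: energy_bounded_def)
  have "energy r (F (K u)) \<le> a * b * energy p u" if "u \<in> L2 p" for u
  proof -
    have "energy r (F (K u)) \<le> a * energy q (K u)"
      using a(2) b(2)[OF that] by blast
    also have "\<dots> \<le> a * (b * energy p u)"
      using a(1) b(2)[OF that] by (intro mult_left_mono) auto
    finally show ?thesis by (simp add: mult.assoc)
  qed
  with a b show ?thesis
    unfolding energy_bounded_def by (intro exI[of _ "a * b"]) auto
qed

lemma energy_bounded_add:
  assumes "energy_bounded q r F" "energy_bounded q r K"
  shows "energy_bounded q r (F + K)"
proof -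
  obtain a where a: "a > 0" "\<And>u. u \<in> L2 q \<Longrightarrow> F u \<in> L2 r \<and> energy r (F u) \<le> a * energy q u"
    using assms by (auto simp: energy_bounded_def)
  obtain b where b: "b > 0" "\<And>u. u \<in> L2 q \<Longrightarrow> K u \<in> L2 r \<and> energy r (K u) \<le> b * energy q u"
    using assms by (auto simp: energy_bounded_def)
  have "energy r (F u + K u) \<le> (2 * a + 2 * b) * energy q u" if "u \<in> L2 q" for u
    using a(2)[OF that] b(2)[OF that] energy_add_le[of "F u" r "K u"] by (simp add: algebra_simps)
  with a b show ?thesis
    unfolding energy_bounded_def by (intro exI[of _ "2 * a + 2 * b"]) (auto intro: L2_add)
qed

lemma energy_bounded_diff:
  assumes "energy_bounded q r F" "energy_bounded q r K"
  shows "energy_bounded q r (F - K)"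
proof -
  have "energy_bounded q r (- K)"
    using assms(2) by (auto simp: energy_bounded_def inner_L2_def sig_inner_minus L2_minus)
  from energy_bounded_add[OF assms(1) this] show ?thesis by simp
qed

lemma sig_inner_zero: "sig_inner 0 0 = 0"
  by transfer simp

text \<open>Serves maps \<open>F i\<close> that may be unbounded on their own but are controlled
  once a second signal \<open>K i v\<close> is known to have finite energy. The inverse denominators
  are of this kind, with the outputs of \<open>TH\<close> as second signal.\<close>

lemma direct_sum_energy_bound:
  assumes "\<And>i. i \<in> {1..n} \<Longrightarrow> \<exists>C>0. \<forall>v\<in>L2 (q i). K i v \<in> L2 (s i) \<longrightarrow>
      F i v \<in> L2 (r i) \<and> energy (r i) (F i v) \<le> C * (energy (q i) v + energy (s i) (K i v))"
    and K: "\<And>i. i \<in> {1..n} \<Longrightarrow> K i \<in> L2e (q i) \<rightarrow> L2e (s i)"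
  shows "\<exists>C>0. \<forall>v\<in>L2 (offset q (Suc n)). direct_sum n q s K v \<in> L2 (offset s (Suc n)) \<longrightarrow>
      direct_sum n q r F v \<in> L2 (offset r (Suc n)) \<and>
      energy (offset r (Suc n)) (direct_sum n q r F v) \<le>
        C * (energy (offset q (Suc n)) v + energy (offset s (Suc n)) (direct_sum n q s K v))"
proof -
  obtain C where C: "\<And>i. i \<in> {1..n} \<Longrightarrow> C i > 0"
    "\<And>i v. i \<in> {1..n} \<Longrightarrow> v \<in> L2 (q i) \<Longrightarrow> K i v \<in> L2 (s i) \<Longrightarrow> F i v \<in> L2 (r i) \<and>
       energy (r i) (F i v) \<le> C i * (energy (q i) v + energy (s i) (K i v))"
    using assms(1) by metis
  \<comment> \<open>One constant dominating every \<open>C i\<close>; the summand 1 keeps it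
    positive for \<open>n = 0\<close>.\<close>
  let ?C = "1 + (\<Sum>i=1..n. C i)"
  have pos: "0 \<le> (\<Sum>i=1..n. C i)"
    using C(1) by (intro sum_nonneg) (simp add: less_imp_le)
  have C_le: "C i \<le> ?C" if "i \<in> {1..n}" for i
    using member_le_sum[OF that, of C] C(1) by (force intro: less_imp_le)
  have "direct_sum n q r F v \<in> L2 (offset r (Suc n)) \<and>
      energy (offset r (Suc n)) (direct_sum n q r F v) \<le>
        ?C * (energy (offset q (Suc n)) v + energy (offset s (Suc n)) (direct_sum n q s K v))"
    if v: "v \<in> L2 (offset q (Suc n))" and Kv: "direct_sum n q s K v \<in> L2 (offset s (Suc n))" for v
  proof
    let ?b = "\<lambda>i. block (offset q i) (q i) v"
    have bK: "block (offset s i) (s i) (direct_sum n q s K v) = K i (?b i)" if "i \<in> {1..n}" for i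
      using K[OF that] that by (intro block_direct_sum) (auto simp: block_in_L2e)
    have F: "F i (?b i) \<in> L2 (r i)"
        "energy (r i) (F i (?b i)) \<le> ?C * (energy (q i) (?b i) + energy (s i) (K i (?b i)))"
      if i: "i \<in> {1..n}" for i
      using C(2)[OF i block_in_L2[OF v i]] block_in_L2[OF Kv i] bK[OF i]
        mult_right_mono[OF C_le[OF i], of "energy (q i) (?b i) + energy (s i) (K i (?b i))"]
        energy_nonneg[of "q i" "?b i"] energy_nonneg[of "s i" "K i (?b i)"]
      by auto
    have bF: "block (offset r i) (r i) (direct_sum n q r F v) = F i (?b i)" if "i \<in> {1..n}" for i
      using that F by (simp add: block_direct_sum L2_in_L2e)
    show "direct_sum n q r F v \<in> L2 (offset r (Suc n))"
      using F bF by (intro L2_blocks direct_sum_in_L2e) simp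
    \<comment> \<open>Energy is additive over blocks on both sides, so the block estimates are
      simply summed.\<close>
    show "energy (offset r (Suc n)) (direct_sum n q r F v) \<le>
        ?C * (energy (offset q (Suc n)) v + energy (offset s (Suc n)) (direct_sum n q s K v))"
      unfolding energy_blocks sum_distrib_left sum.distrib[symmetric] using F bF bK
      by (intro sum_mono) simp
  qed
  with pos show ?thesis by (intro exI[of _ ?C]) auto
qed

lemma energy_bounded_direct_sum:
  assumes "\<And>i. i \<in> {1..n} \<Longrightarrow> energy_bounded (q i) (r i) (F i)"
  shows "energy_bounded (offset q (Suc n)) (offset r (Suc n)) (direct_sum n q r F)"
proof -
  have zero: "0 \<in> L2 k" "energy k 0 = 0" for k
    by (simp_all add: L2_def L2e_def sig_L2_zero inner_L2_def sig_inner_zero)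
  have "shift_in a k 0 = 0" for a k
    by (simp add: shift_in_def fun_eq_iff)
  then have sum_zero: "direct_sum n q r (\<lambda>_ _. 0) v = 0" for v
    by (simp add: direct_sum_def)
  \<comment> \<open>With the zero map as second signal, the side condition holds trivially and the
    extra energy term disappears.\<close>
  have "\<exists>C>0. \<forall>v\<in>L2 (offset q (Suc n)). direct_sum n q r (\<lambda>_ _. 0) v \<in> L2 (offset r (Suc n)) \<longrightarrow>
      direct_sum n q r F v \<in> L2 (offset r (Suc n)) \<and>
      energy (offset r (Suc n)) (direct_sum n q r F v) \<le>
        C * (energy (offset q (Suc n)) v + energy (offset r (Suc n)) (direct_sum n q r (\<lambda>_ _. 0) v))"
    using assms by (intro direct_sum_energy_bound) (simp_all add: energy_bounded_def zero L2_in_L2e)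
  then show ?thesis
    unfolding sum_zero by (simp add: energy_bounded_def zero)
qed

lemma ones_apply: "ones r (Suc 0) w = (\<lambda>k. if k \<in> {1..r} then w (Suc 0) else 0)"
  by (simp add: ones_def mat_map_def fun_eq_iff)

lemma energy_bounded_ones: "energy_bounded 1 r (ones r 1)"
  unfolding energy_bounded_def
\<comment> \<open>The energy is multiplied by exactly \<open>r\<close>; adding 1 makes the constant
  positive when \<open>r = 0\<close>.\<close>
proof (intro exI[of _ "1 + real r"] conjI ballI)
  fix v assume v: "v \<in> L2 1"
  then show "ones r 1 v \<in> L2 r"
    by (auto simp: ones_apply L2_def L2e_def)
  show "energy r (ones r 1 v) \<le> (1 + real r) * energy 1 v"
    by (simp add: ones_apply inner_L2_def mult_right_mono sig_inner_self_nonneg)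
qed simp

text \<open>Converse to the bound on \<open>ones\<close>: when there is at least one copy of
  \<open>w\<close>, the first copy already determines it.\<close>

lemma ones_L2_D:
  assumes "1 \<le> r" "w \<in> L2e 1" "ones r 1 w \<in> L2 r"
  shows "w \<in> L2 1" and "energy 1 w \<le> energy r (ones r 1 w)"
proof -
  have "sig_L2 (ones r 1 w 1)"
    using assms(1,3) by (simp add: L2_def)
  with assms show "w \<in> L2 1"
    by (simp add: ones_apply L2_def)
  have "energy 1 w \<le> (\<Sum>k=1..r. sig_inner (w 1) (w 1))"
    using assms(1) mult_right_mono[of 1 "real r" "sig_inner (w 1) (w 1)"] sig_inner_self_nonneg[of "w 1"]
    by (simp add: inner_L2_def)
  then show "energy 1 w \<le> energy r (ones r 1 w)"
    by (simp add: inner_L2_def ones_apply)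
qed

section \<open>Degrees in the graph and the routing permutation\<close>

text \<open>Double counting of vertex-edge incidences. It reconciles the two forms of the dimension:
  \<open>2 * card E\<close> for the matrix \<open>P\<close>, the sum of the degrees for the direct
  sums.\<close>

lemma handshake:
  assumes "simple_graph n E"
  shows "offset (deg E) (Suc n) = 2 * card E"
proof -
  have E: "e \<subseteq> {1..n}" "card e = 2" if "e \<in> E" for e
    using assms that by (auto simp: simple_graph_def)
  have fin: "finite E"
    by (rule finite_subset[of _ "Pow {1..n}"]) (use E in auto)
  have "deg E i = card {e \<in> E. i \<in> e}" for i
  proof -
    \<comment> \<open>An edge at \<open>i\<close> has exactly one other end, so the neighbours of
      \<open>i\<close> correspond to the edges containing \<open>i\<close>.\<close>
    have "bij_betw (\<lambda>j. {i, j}) (nbrs E i) {e \<in> E. i \<in> e}"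
    proof (rule bij_betwI')
      show "({i, x} = {i, y}) = (x = y)" if "x \<in> nbrs E i" "y \<in> nbrs E i" for x y
        by (auto simp: doubleton_eq_iff)
      show "\<exists>x\<in>nbrs E i. e = {i, x}" if "e \<in> {e \<in> E. i \<in> e}" for e
      proof -
        have "card e = 2" "i \<in> e" "e \<in> E" using that E by auto
        then obtain x where "e = {i, x}" by (auto simp: card_2_iff)
        with \<open>e \<in> E\<close> show ?thesis by (auto simp: nbrs_def)
      qed
    qed (auto simp: nbrs_def)
    then show ?thesis by (simp add: deg_def bij_betw_same_card)
  qed
  then have "offset (deg E) (Suc n) = (\<Sum>i\<in>{1..n}. card {e \<in> E. i \<in> e})"
    by (simp add: offset_def atLeastLessThanSuc_atLeastAtMost)
  also have "\<dots> = (\<Sum>e\<in>E. 2)"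
  proof (rule sum_multicount_gen)
    show "\<forall>e\<in>E. card {i \<in> {1..n}. i \<in> e} = 2"
    proof
      fix e assume e: "e \<in> E"
      then have "{i \<in> {1..n}. i \<in> e} = e" using E by blast
      with E e show "card {i \<in> {1..n}. i \<in> e} = 2" by simp
    qed
  qed (simp_all add: fin)
  finally show ?thesis by simp
qed

lemma nbrs_subset: "simple_graph n E \<Longrightarrow> nbrs E i \<subseteq> {1..n}"
  by (auto simp: simple_graph_def nbrs_def)

text \<open>A path from \<open>i\<close> to any other vertex must start with an edge at
  \<open>i\<close>; \<open>n \<ge> 2\<close> supplies such a vertex.\<close>

lemma connected_deg_pos:
  assumes "simple_graph n E" "connected_graph n E" "n \<ge> 2" "i \<in> {1..n}"
  shows "1 \<le> deg E i"
proof -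
  define j :: nat where "j = (if i = 1 then 2 else 1)"
  have j: "j \<in> {1..n}" "j \<noteq> i"
    using assms by (auto simp: j_def)
  then have "(i, j) \<in> {(a, b). {a, b} \<in> E}\<^sup>*"
    using assms by (simp add: connected_graph_def)
  then obtain b where "{i, b} \<in> E"
    using j by (auto elim: converse_rtranclE)
  then have "nbrs E i \<noteq> {}" by (auto simp: nbrs_def)
  moreover have "finite (nbrs E i)"
    using nbrs_subset[OF assms(1)] by (rule finite_subset) simp
  ultimately show ?thesis by (simp add: deg_def Suc_le_eq card_gt_0_iff)
qed

text \<open>The index \<open>offset (deg E) i + k\<close> stands for the directed edge from
  \<open>i\<close> to its \<open>k\<close>-th neighbour. The matrix sends each directed edge to its
  reversal, and reversing twice changes nothing.\<close>

lemma perm_matrix_involution: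
  assumes graph: "simple_graph n E"
    and kappa: "\<forall>i\<in>{1..n}. bij_betw (\<kappa> i) (nbrs E i) {1..deg E i}"
  obtains \<sigma> where "\<And>r. r \<in> {1..2 * card E} \<Longrightarrow> \<sigma> r \<in> {1..2 * card E}"
    and "\<And>r. r \<in> {1..2 * card E} \<Longrightarrow> \<sigma> (\<sigma> r) = r"
    and "\<And>r q. r \<in> {1..2 * card E} \<Longrightarrow> perm_matrix n E \<kappa> r q = (if q = \<sigma> r then 1 else 0)"
proof -
  let ?d = "deg E"
  let ?s = "offset ?d"
  let ?nb = "\<lambda>i k. inv_into (nbrs E i) (\<kappa> i) k"
  have tot: "2 * card E = ?s (Suc n)" using handshake[OF graph] by simp
  \<comment> \<open>Read off from the matrix: the column of the only nonzero entry in row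
    \<open>r\<close>.\<close>
  define \<sigma> where "\<sigma> r = (THE q. perm_matrix n E \<kappa> r q = 1)" for r
  have nb: "?nb i k \<in> nbrs E i" "\<kappa> i (?nb i k) = k" if "i \<in> {1..n}" "k \<in> {1..?d i}" for i k
    using kappa that by (auto simp: bij_betw_def intro!: inv_into_into f_inv_into_f)
  have perm: "perm_matrix n E \<kappa> (?s i + k) q = (if q = ?s (?nb i k) + \<kappa> (?nb i k) i then 1 else 0)"
    if ik: "i \<in> {1..n}" "k \<in> {1..?d i}" for i k q
  proof -
    \<comment> \<open>Uniqueness of block coordinates collapses the existential in
      \<open>perm_matrix\<close> to the one pair \<open>(i, k)\<close>.\<close>
    have "i' = i \<and> k' = k" if "i' \<in> {1..n}" "k' \<in> {1..?d i'}" "?s i + k = ?s i' + k'" for i' k'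
      using offset_unique[of i i' k ?d k'] that ik by simp
    then have "(\<exists>i'\<in>{1..n}. \<exists>k'\<in>{1..?d i'}. ?s i + k = ?s i' + k' \<and>
        (let j = ?nb i' k' in q = ?s j + \<kappa> j i')) \<longleftrightarrow> q = ?s (?nb i k) + \<kappa> (?nb i k) i"
      using ik unfolding Let_def by metis
    then show ?thesis by (simp add: perm_matrix_def)
  qed
  have \<sigma>: "\<sigma> (?s i + k) = ?s (?nb i k) + \<kappa> (?nb i k) i" if "i \<in> {1..n}" "k \<in> {1..?d i}" for i k
    unfolding \<sigma>_def perm[OF that] by (rule the_equality) (auto split: if_splits)
  \<comment> \<open>Reversing an edge stays within the index range, and seen from the neighbour
    \<open>j\<close> the port \<open>\<kappa> j i\<close> leads back to \<open>i\<close>.\<close>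
  have nb': "?nb i k \<in> {1..n}" "\<kappa> (?nb i k) i \<in> {1..?d (?nb i k)}"
      "?nb (?nb i k) (\<kappa> (?nb i k) i) = i" if ik: "i \<in> {1..n}" "k \<in> {1..?d i}" for i k
  proof -
    let ?j = "?nb i k"
    show j: "?j \<in> {1..n}" using nb(1)[OF ik] nbrs_subset[OF graph] by blast
    have i: "i \<in> nbrs E ?j" using nb(1)[OF ik] by (simp add: nbrs_def insert_commute)
    have bij: "bij_betw (\<kappa> ?j) (nbrs E ?j) {1..?d ?j}" using kappa j by blast
    show "\<kappa> ?j i \<in> {1..?d ?j}" using bij i by (rule bij_betwE[THEN bspec])
    show "?nb ?j (\<kappa> ?j i) = i" using bij i by (rule bij_betw_inv_into_left)
  qed
  show thesis
  proof (rule that[of \<sigma>])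
    fix r assume "r \<in> {1..2 * card E}"
    then obtain i k where ik: "i \<in> {1..n}" "k \<in> {1..?d i}" and r: "r = ?s i + k"
      unfolding tot using offset_decompose by blast
    show "\<sigma> r \<in> {1..2 * card E}"
      unfolding r tot \<sigma>[OF ik] by (rule offset_add_le_total[where d = ?d]) (use nb'[OF ik] in auto)
    show "\<sigma> (\<sigma> r) = r"
      unfolding r \<sigma>[OF ik] by (subst \<sigma>) (use nb'[OF ik] nb[OF ik] in auto)
    show "perm_matrix n E \<kappa> r q = (if q = \<sigma> r then 1 else 0)" for q
      unfolding r \<sigma>[OF ik] by (rule perm[OF ik])
  qed
qed

lemma mat_map_permutation:
  assumes "\<And>k. k \<in> {1..p} \<Longrightarrow> \<sigma> k \<in> {1..p}"
    and "\<And>k j. k \<in> {1..p} \<Longrightarrow> A k j = (if j = \<sigma> k then 1 else 0)"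
  shows "mat_map p p A v = (\<lambda>k. if k \<in> {1..p} then v (\<sigma> k) else 0)"
proof
  fix k
  have "(\<Sum>j=1..p. A k j *\<^sub>R v j) = v (\<sigma> k)" if "k \<in> {1..p}"
  proof -
    have "(\<Sum>j=1..p. A k j *\<^sub>R v j) = (\<Sum>j=1..p. if j = \<sigma> k then v j else 0)"
      using assms(2)[OF that] by (intro sum.cong) auto
    with assms(1)[OF that] show ?thesis by simp
  qed
  then show "mat_map p p A v k = (if k \<in> {1..p} then v (\<sigma> k) else 0)"
    by (simp add: mat_map_def)
qed

lemma perm_matrix_map:
  assumes graph: "simple_graph n E"
    and kappa: "\<forall>i\<in>{1..n}. bij_betw (\<kappa> i) (nbrs E i) {1..deg E i}"
  defines "p \<equiv> 2 * card E"
  defines "P \<equiv> mat_map p p (perm_matrix n E \<kappa>)"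
  shows "P v \<in> L2e p"
    and "v \<in> L2e p \<Longrightarrow> P (P v) = v"
    and "energy_bounded p p P"
proof -
  obtain \<sigma> where \<sigma>: "\<And>r. r \<in> {1..p} \<Longrightarrow> \<sigma> r \<in> {1..p}"
      "\<And>r. r \<in> {1..p} \<Longrightarrow> \<sigma> (\<sigma> r) = r"
      "\<And>r q. r \<in> {1..p} \<Longrightarrow> perm_matrix n E \<kappa> r q = (if q = \<sigma> r then 1 else 0)"
    by (rule perm_matrix_involution[OF graph kappa, folded p_def]) (rule that)
  have P: "P v = (\<lambda>k. if k \<in> {1..p} then v (\<sigma> k) else 0)" for v
    unfolding P_def using \<sigma>(1,3) by (rule mat_map_permutation[where A = "perm_matrix n E \<kappa>"])
  show "P v \<in> L2e p" by (auto simp: P L2e_def)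
  show "P (P v) = v" if "v \<in> L2e p"
    using that \<sigma>(1,2) by (auto simp: P L2e_def fun_eq_iff)
  \<comment> \<open>\<open>\<sigma>\<close> is its own inverse on the index range, so
    \<open>P\<close> only reorders the summands.\<close>
  have "energy p (P v) = energy p v" for v
    unfolding inner_L2_def using \<sigma>(1,2)
    by (intro sum.reindex_bij_witness[of _ \<sigma> \<sigma>]) (simp_all add: P)
  moreover have "P v \<in> L2 p" if "v \<in> L2 p" for v
    using that \<sigma>(1) by (auto simp: P L2_def L2e_def)
  ultimately show "energy_bounded p p P"
    unfolding energy_bounded_def by (intro exI[of _ 1]) simp
qed

section \<open>Stacked signals, the nominal loop and coprime factors\<close>

lemma stack_apply:
  "stack r q y u k = (if k \<in> {1..r} then y k else if k \<in> {r+1..r+q} then u (k - r) else 0)"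
  by (auto simp: stack_def shift_in_def)

lemma block_stack:
  assumes "y \<in> L2e r" "u \<in> L2e q"
  shows "block 0 r (stack r q y u) = y" "block r q (stack r q y u) = u"
  using assms by (auto simp: block_def stack_apply L2e_def fun_eq_iff)

lemma energy_stack: "energy (r + q) (stack r q y u) = energy r y + energy q u"
proof -
  have "energy (r + q) (stack r q y u)
      = (\<Sum>k=1..r. sig_inner (stack r q y u k) (stack r q y u k))
        + (\<Sum>k=1+r..q+r. sig_inner (stack r q y u k) (stack r q y u k))"
    unfolding inner_L2_def by (subst sum.ub_add_nat) (simp_all add: add.commute)
  then show ?thesis
    unfolding sum.shift_bounds_cl_nat_ivl by (simp add: inner_L2_def stack_apply)
qed

lemma stack_L2_iff:
  assumes "y \<in> L2e r" "u \<in> L2e q"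
  shows "stack r q y u \<in> L2 (r + q) \<longleftrightarrow> y \<in> L2 r \<and> u \<in> L2 q"
proof
  assume L: "stack r q y u \<in> L2 (r + q)"
  have "sig_L2 (y k)" if "k \<in> {1..r}" for k
    using L that by (auto simp: L2_def stack_apply dest!: bspec[of _ _ k])
  moreover have "sig_L2 (u k)" if "k \<in> {1..q}" for k
    using L that by (auto simp: L2_def stack_apply dest!: bspec[of _ _ "r + k"])
  ultimately show "y \<in> L2 r \<and> u \<in> L2 q"
    using assms by (simp add: L2_def)
next
  assume "y \<in> L2 r \<and> u \<in> L2 q"
  then have "sig_L2 (y k)" if "k \<in> {1..r}" for k using that by (simp add: L2_def)
  moreover have "sig_L2 (u (k - r))" if "k \<in> {r+1..r+q}" for k
  proof -
    have "k - r \<in> {1..q}" using that by auto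
    with \<open>y \<in> L2 r \<and> u \<in> L2 q\<close> show ?thesis by (simp add: L2_def)
  qed
  ultimately show "stack r q y u \<in> L2 (r + q)"
    by (auto simp: L2_def L2e_def stack_apply)
qed

text \<open>As \<open>P\<close> is an involution, the closed loop with \<open>d\<^sub>y = 0\<close> says \<open>u = P y\<close> and
  \<open>(P - K) y = d\<^sub>u\<close>.\<close>

lemma nominal_inverse:
  assumes fb: "fb_stable p p P K"
    and P: "\<And>v. P v \<in> L2e p" and PP: "\<And>v. v \<in> L2e p \<Longrightarrow> P (P v) = v"
    and K: "\<And>v. K v \<in> L2e p"
  shows "bij_betw (P - K) (L2e p) (L2e p)"
    and "energy_bounded p p (inv_into (L2e p) (P - K))"
proof -
  have zero: "0 \<in> L2e p" by (simp add: L2e_def)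
  have ex1: "\<exists>!s. fb_solution p p P K 0 u s" if "u \<in> L2e p" for u
    using fb that zero by (simp add: fb_stable_def well_posed_def)
  have sol: "fb_solution p p P K 0 u (y, w) \<longleftrightarrow> y \<in> L2e p \<and> w = P y \<and> (P - K) y = u"
    for u y w
  proof -
    have "y \<in> L2e p \<and> w \<in> L2e p \<and> y = P w \<longleftrightarrow> y \<in> L2e p \<and> w = P y"
      using P PP by metis
    moreover have "P y = K y + u \<longleftrightarrow> (P - K) y = u"
      by (auto simp: algebra_simps)
    ultimately show ?thesis by (auto simp: fb_solution_def)
  qed
  have ran: "(P - K) y \<in> L2e p" for y
    using P[of y] K[of y] by (simp add: L2e_def)
  have inj: "inj_on (P - K) (L2e p)"
  proof (rule inj_onI)
    fix y y' assume "y \<in> L2e p" "y' \<in> L2e p" "(P - K) y = (P - K) y'"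
    then have "fb_solution p p P K 0 ((P - K) y) (y, P y)"
        "fb_solution p p P K 0 ((P - K) y) (y', P y')"
      unfolding sol by auto
    then show "y = y'" using ex1[OF ran[of y]] by blast
  qed
  have ex: "\<exists>y\<in>L2e p. (P - K) y = u" if u: "u \<in> L2e p" for u
  proof -
    obtain y w where "fb_solution p p P K 0 u (y, w)"
      using ex1[OF u] by (metis surj_pair)
    then show ?thesis unfolding sol by blast
  qed
  show bij: "bij_betw (P - K) (L2e p) (L2e p)"
    unfolding bij_betw_def using inj ran ex by blast
  let ?Q = "inv_into (L2e p) (P - K)"
  have "energy_bounded (p + p) (p + p) (fb_map p p P K)"
    using fb by (intro stable_system_energy_bounded) (simp add: fb_stable_def)
  then obtain C where C: "C > 0" "\<And>v. v \<in> L2 (p + p) \<Longrightarrow>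
      fb_map p p P K v \<in> L2 (p + p) \<and> energy (p + p) (fb_map p p P K v) \<le> C * energy (p + p) v"
    by (auto simp: energy_bounded_def)
  have "?Q u \<in> L2 p \<and> energy p (?Q u) \<le> C * energy p u" if u: "u \<in> L2 p" for u
  proof -
    \<comment> \<open>With the first disturbance set to 0, the loop responds with
      \<open>(?Q u, P (?Q u))\<close>. The closed-loop energy constant \<open>C\<close> therefore
      serves for \<open>?Q\<close> as well, the energy of the second component being
      nonnegative.\<close>
    let ?v = "stack p p 0 u"
    have Q: "?Q u \<in> L2e p" "(P - K) (?Q u) = u"
      using bij_betw_apply[OF bij_betw_inv_into[OF bij]] bij_betw_inv_into_right[OF bij]
        L2_in_L2e[OF u] by blast+
    have "fb_solution p p P K 0 u (?Q u, P (?Q u))"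
      using Q by (simp add: sol)
    then have "fb_map p p P K ?v = stack p p (?Q u) (P (?Q u))"
      unfolding fb_map_def using ex1[OF L2_in_L2e[OF u]]
      by (simp add: block_stack zero L2_in_L2e[OF u] the1_equality)
    moreover have "?v \<in> L2 (p + p)"
      using u zero by (subst stack_L2_iff) (auto simp: L2_def sig_L2_zero)
    ultimately have "stack p p (?Q u) (P (?Q u)) \<in> L2 (p + p)"
        "energy p (?Q u) + energy p (P (?Q u)) \<le> C * (energy p 0 + energy p u)"
      using C(2)[of ?v] by (simp_all add: energy_stack)
    moreover have "energy p 0 = 0"
      by (simp add: inner_L2_def sig_inner_zero)
    ultimately show ?thesis
      using Q(1) P energy_nonneg[of p "P (?Q u)"] by (simp add: stack_L2_iff)
  qed
  with C(1) show "energy_bounded p p ?Q"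
    unfolding energy_bounded_def by blast
qed

text \<open>The coprimeness identity turns \<open>z = D\<inverse> y\<close> into \<open>z = U (H y) + V y\<close>, so that \<open>z\<close> has
  finite energy although \<open>D\<inverse>\<close> may be unbounded.\<close>

lemma coprime_factor_energy_bounded:
  assumes U: "energy_bounded 1 r U" and V: "energy_bounded r r V"
    and bezout: "\<And>v. v \<in> L2e r \<Longrightarrow> U (N v) + V (D v) = v"
    and D: "bij_betw D (L2e r) (L2e r)" and N: "N \<in> L2e r \<rightarrow> L2e 1" and r: "1 \<le> r"
  shows "\<exists>C>0. \<forall>y\<in>L2 r. ones r 1 (N (inv_into (L2e r) D y)) \<in> L2 r \<longrightarrow>
           inv_into (L2e r) D y \<in> L2 r \<and> energy r (inv_into (L2e r) D y) \<le>
             C * (energy r y + energy r (ones r 1 (N (inv_into (L2e r) D y))))"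
proof -
  obtain a where a: "a > 0" "\<And>u. u \<in> L2 1 \<Longrightarrow> U u \<in> L2 r \<and> energy r (U u) \<le> a * energy 1 u"
    using U by (auto simp: energy_bounded_def)
  obtain b where b: "b > 0" "\<And>u. u \<in> L2 r \<Longrightarrow> V u \<in> L2 r \<and> energy r (V u) \<le> b * energy r u"
    using V by (auto simp: energy_bounded_def)
  \<comment> \<open>\<open>a\<close> and \<open>b\<close> are the energy constants of
    \<open>U\<close> and \<open>V\<close>; the factor 2 comes from
    \<open>energy_add_le\<close>.\<close>
  have "inv_into (L2e r) D y \<in> L2 r \<and> energy r (inv_into (L2e r) D y) \<le>
             (2 * a + 2 * b) * (energy r y + energy r (ones r 1 (N (inv_into (L2e r) D y))))"
    if y: "y \<in> L2 r" and t: "ones r 1 (N (inv_into (L2e r) D y)) \<in> L2 r" for y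
  proof -
    define z where "z = inv_into (L2e r) D y"
    have z: "z \<in> L2e r" "D z = y"
      using bij_betw_apply[OF bij_betw_inv_into[OF D]] bij_betw_inv_into_right[OF D]
        L2_in_L2e[OF y] unfolding z_def by blast+
    then have eq: "U (N z) + V y = z" using bezout[of z] by simp
    have Nz: "N z \<in> L2e 1" using N z by blast
    \<comment> \<open>Finite energy passes from the \<open>r\<close> copies of \<open>N z\<close>
      back to \<open>N z\<close> itself.\<close>
    note t' = ones_L2_D[OF r Nz t[folded z_def]]
    have L: "U (N z) \<in> L2 r" "V y \<in> L2 r"
      using a(2)[OF t'(1)] b(2)[OF y] by auto
    have "energy r z \<le> 2 * energy r (U (N z)) + 2 * energy r (V y)"
      using energy_add_le[OF L] eq by simp
    also have "\<dots> \<le> 2 * (a * energy r (ones r 1 (N z))) + 2 * (b * energy r y)"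
      using a b(2)[OF y] a(2)[OF t'(1)] mult_left_mono[OF t'(2), of a] by linarith
    also have "\<dots> \<le> (2 * a + 2 * b) * (energy r y + energy r (ones r 1 (N z)))"
      using a(1) b(1) energy_nonneg[of r y] energy_nonneg[of r "ones r 1 (N z)"]
      by (simp add: algebra_simps)
    finally show ?thesis
      using L2_add[OF L] eq unfolding z_def by simp
  qed
  with a(1) b(1) show ?thesis
    by (intro exI[of _ "2 * a + 2 * b"]) auto
qed

section \<open>Change of variables in the strict negativity condition\<close>

text \<open>\<open>M\<close> and \<open>R\<close> are mutually inverse on \<open>L2 p\<close>, so
  both conditions concern the same values of \<open>q\<close>. They differ only in the energy on the
  right, and the two bounds make these energies comparable.\<close>

lemma negativity_reparametrization:
  assumes M: "energy_bounded p p M" and R: "energy_bounded p p R"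
    and MR: "\<And>u. u \<in> L2 p \<Longrightarrow> M (R u) = u" and RM: "\<And>z. z \<in> L2 p \<Longrightarrow> R (M z) = z"
    and NG: "\<And>u. u \<in> L2 p \<Longrightarrow> N (R u) = G u"
  shows "(\<exists>\<epsilon>>0. \<forall>u\<in>L2 p. (q (G u) u :: real) \<le> - \<epsilon> * (norm_L2 p u)\<^sup>2) \<longleftrightarrow>
    (\<exists>\<epsilon>>0. \<forall>z\<in>L2 p. q (N z) (M z) \<le> - \<epsilon> * (norm_L2 p z)\<^sup>2)"
proof -
  obtain a where a: "a > 0" "\<And>z. z \<in> L2 p \<Longrightarrow> M z \<in> L2 p \<and> energy p (M z) \<le> a * energy p z"
    using M by (auto simp: energy_bounded_def)
  obtain b where b: "b > 0" "\<And>u. u \<in> L2 p \<Longrightarrow> R u \<in> L2 p \<and> energy p (R u) \<le> b * energy p u"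
    using R by (auto simp: energy_bounded_def)
  have weaken: "x \<le> - (\<epsilon> / c) * t" if "x \<le> - \<epsilon> * s" "t \<le> c * s" "\<epsilon> > 0" "c > 0"
    for x s t \<epsilon> c :: real
  proof -
    have "\<epsilon> / c * t \<le> \<epsilon> / c * (c * s)" using that by (intro mult_left_mono) auto
    with that show ?thesis by simp
  qed
  show ?thesis
    unfolding norm_L2_sq
  proof
    assume "\<exists>\<epsilon>>0. \<forall>u\<in>L2 p. q (G u) u \<le> - \<epsilon> * energy p u"
    then obtain \<epsilon> where \<epsilon>: "\<epsilon> > 0" "\<And>u. u \<in> L2 p \<Longrightarrow> q (G u) u \<le> - \<epsilon> * energy p u"
      by blast
    \<comment> \<open>Take \<open>u = M z\<close>. Since \<open>z = R (M z)\<close>, the energy of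
      \<open>z\<close> is at most \<open>b\<close> times that of \<open>M z\<close>, which costs the
      factor \<open>1 / b\<close>.\<close>
    have "q (N z) (M z) \<le> - (\<epsilon> / b) * energy p z" if z: "z \<in> L2 p" for z
      using weaken[OF \<epsilon>(2) _ \<epsilon>(1) b(1), of "M z"] a(2)[OF z] b(2)[of "M z"] NG[of "M z"] RM[OF z]
      by simp
    with \<epsilon>(1) b(1) show "\<exists>\<epsilon>>0. \<forall>z\<in>L2 p. q (N z) (M z) \<le> - \<epsilon> * energy p z"
      by (intro exI[of _ "\<epsilon> / b"]) auto
  next
    assume "\<exists>\<epsilon>>0. \<forall>z\<in>L2 p. q (N z) (M z) \<le> - \<epsilon> * energy p z"
    then obtain \<epsilon> where \<epsilon>: "\<epsilon> > 0" "\<And>z. z \<in> L2 p \<Longrightarrow> q (N z) (M z) \<le> - \<epsilon> * energy p z"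
      by blast
    \<comment> \<open>Symmetrically with \<open>z = R u\<close>, where \<open>u = M z\<close> has at
      most \<open>a\<close> times the energy of \<open>z\<close>.\<close>
    have "q (G u) u \<le> - (\<epsilon> / a) * energy p u" if u: "u \<in> L2 p" for u
      using weaken[OF \<epsilon>(2) _ \<epsilon>(1) a(1), of "R u"] b(2)[OF u] a(2)[of "R u"] NG[OF u] MR[OF u]
      by simp
    with \<epsilon>(1) a(1) show "\<exists>\<epsilon>>0. \<forall>u\<in>L2 p. q (G u) u \<le> - \<epsilon> * energy p u"
      by (intro exI[of _ "\<epsilon> / a"]) auto
  qed
qed

section \<open>The network: identities and energy bounds for \<open>M\<close>, \<open>N\<close> and
  \<open>R\<close>\<close>

theorem lemma1:
  fixes n m :: nat and E :: "nat set set" and \<kappa> :: "nat \<Rightarrow> nat \<Rightarrow> nat" and d :: "nat \<Rightarrow> nat"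
    and Hi Si Sdi Ni Di \<Pi>1i \<Pi>2i \<Pi>3i :: "nat \<Rightarrow> vsig \<Rightarrow> vsig"
    and \<Lambda>ik :: "nat \<Rightarrow> nat \<Rightarrow> vsig \<Rightarrow> vsig"
    and \<Lambda>i \<Delta>i :: "nat \<Rightarrow> vsig \<Rightarrow> vsig"
    and domi :: "nat \<Rightarrow> vsig set" and dom_Sd :: "vsig set"
    and P T H TH Q \<Lambda> S Sd \<Delta> G N M \<Pi>1 \<Pi>2 \<Pi>3 :: "vsig \<Rightarrow> vsig"
  defines "m \<equiv> card E"
    and "d \<equiv> deg E"
    and "P \<equiv> mat_map (2 * m) (2 * m) (perm_matrix n E \<kappa>)"
    and "T \<equiv> direct_sum n (\<lambda>_. 1) d (\<lambda>i. ones (d i) 1)"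
    and "H \<equiv> direct_sum n d (\<lambda>_. 1) Hi"
    and "\<Lambda>i \<equiv> (\<lambda>i. direct_sum (d i) (\<lambda>_. 1) (\<lambda>_. 1) (\<Lambda>ik i))"
    and "\<Lambda> \<equiv> direct_sum n d d \<Lambda>i"
    and "S \<equiv> direct_sum n (\<lambda>_. 1) (\<lambda>_. 1) Si"
    and "Sd \<equiv> direct_sum n (\<lambda>_. 1) (\<lambda>_. 1) Sdi"
    and "dom_Sd \<equiv> {v \<in> L2e n. \<forall>i\<in>{1..n}. block (i - 1) 1 v \<in> domi i}"
    and "TH \<equiv> T \<circ> H"
    and "Q \<equiv> inv_into (L2e (2 * m)) (P - TH)"
    and "\<Delta>i \<equiv> (\<lambda>i. (\<Lambda>i i - id) \<circ> (ones (d i) 1 \<circ> Si i))"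
    and "\<Delta> \<equiv> (\<Lambda> - id) \<circ> (T \<circ> S)"
    and "G \<equiv> Sd \<circ> H \<circ> Q"
    and "N \<equiv> direct_sum n d (\<lambda>_. 1) (\<lambda>i. Sdi i \<circ> Ni i)"
    and "M \<equiv> (P \<circ> direct_sum n d d Di) - direct_sum n d d (\<lambda>i. ones (d i) 1 \<circ> Ni i)"
    and "\<Pi>1 \<equiv> direct_sum n (\<lambda>_. 1) (\<lambda>_. 1) \<Pi>1i"
    and "\<Pi>2 \<equiv> direct_sum n d (\<lambda>_. 1) \<Pi>2i"
    and "\<Pi>3 \<equiv> direct_sum n d d \<Pi>3i"
  assumes n: "n \<ge> 2"
    and graph: "simple_graph n E" "connected_graph n E"
    and kappa: "\<forall>i\<in>{1..n}. bij_betw (\<kappa> i) (nbrs E i) {1..d i}"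
    and agents: "\<forall>i\<in>{1..n}. linear_map (d i) 1 (Hi i) \<and> causal (d i) 1 (Hi i)"
    and links: "\<forall>i\<in>{1..n}. \<forall>k\<in>{1..d i}. causal 1 1 (\<Lambda>ik i k)"
    and nominal: "fb_stable (2 * m) (2 * m) P TH"
    and S_linear: "\<forall>i\<in>{1..n}. linear_map 1 1 (Si i)"
    and Sd_linear: "\<forall>i\<in>{1..n}. partial_linear_map 1 1 (domi i) (Sdi i)"
    and G_defined: "\<forall>u\<in>L2e (2 * m). H (Q u) \<in> dom_Sd"
    and Delta_stable: "stable_system n (2 * m) \<Delta>"
    and G_stable: "stable_system (2 * m) n G"
    and loop: "\<forall>u\<in>L2e (2 * m). (\<Delta> \<circ> G) u = ((\<Lambda> - id) \<circ> TH \<circ> Q) u"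
    and N_D: "\<forall>i\<in>{1..n}. stable_system (d i) 1 (Ni i) \<and> linear_map (d i) 1 (Ni i) \<and>
                         stable_system (d i) (d i) (Di i) \<and> linear_map (d i) (d i) (Di i)"
    and factorization: "\<forall>i\<in>{1..n}. bij_betw (Di i) (L2e (d i)) (L2e (d i)) \<and>
                         (\<forall>v\<in>L2e (d i). Hi i v = Ni i (inv_into (L2e (d i)) (Di i) v))"
    and coprime: "\<forall>i\<in>{1..n}. \<exists>Ui Vi. stable_system 1 (d i) Ui \<and> linear_map 1 (d i) Ui \<and>
                         stable_system (d i) (d i) Vi \<and> linear_map (d i) (d i) Vi \<and>
                         (\<forall>v\<in>L2e (d i). Ui (Ni i v) + Vi (Di i v) = v)"
    and Pi_blocks: "\<forall>i\<in>{1..n}. bounded_linear_L2 1 1 (\<Pi>1i i) \<and>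
                         bounded_linear_L2 (d i) 1 (\<Pi>2i i) \<and> bounded_linear_L2 (d i) (d i) (\<Pi>3i i)"
    and Pi_bar: "\<forall>i\<in>{1..n}.
           bounded_linear_L2 (1 + d i) (1 + d i) (multiplier 1 (d i) (\<Pi>1i i) (\<Pi>2i i) (\<Pi>3i i)) \<and>
           self_adjoint_L2 (1 + d i) (multiplier 1 (d i) (\<Pi>1i i) (\<Pi>2i i) (\<Pi>3i i))"
    and iqc: "\<forall>i\<in>{1..n}. \<forall>y\<in>L2 1. \<forall>\<alpha>\<in>{0..1}.
           quad_form 1 (d i) (\<Pi>1i i) (\<Pi>2i i) (\<Pi>3i i) y (\<alpha> *\<^sub>R \<Delta>i i y) \<ge> 0"
  shows "(\<exists>\<epsilon>>0. \<forall>u\<in>L2 (2 * m). quad_form n (2 * m) \<Pi>1 \<Pi>2 \<Pi>3 (G u) u \<le> - \<epsilon> * (norm_L2 (2 * m) u)\<^sup>2)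
     \<longleftrightarrow> (\<exists>\<epsilon>>0. \<forall>z\<in>L2 (2 * m). quad_form n (2 * m) \<Pi>1 \<Pi>2 \<Pi>3 (N z) (M z) \<le> - \<epsilon> * (norm_L2 (2 * m) z)\<^sup>2)"
proof -
  define p where "p = 2 * m"
  define Dinv where "Dinv = (\<lambda>i. inv_into (L2e (d i)) (Di i))"
  define D where "D = direct_sum n d d Di"
  define R where "R = direct_sum n d d Dinv \<circ> Q"
  have p: "p = offset d (Suc n)"
    using handshake[OF graph(1)] by (simp add: p_def m_def d_def)
  have d_pos: "1 \<le> d i" if "i \<in> {1..n}" for i
    using connected_deg_pos[OF graph n that] by (simp add: d_def)
  have maps: "Ni i \<in> L2e (d i) \<rightarrow> L2e 1" "Di i \<in> L2e (d i) \<rightarrow> L2e (d i)"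
      "Hi i \<in> L2e (d i) \<rightarrow> L2e 1" if "i \<in> {1..n}" for i
    using N_D agents that by (auto simp: linear_map_def)
  have Dbij: "bij_betw (Di i) (L2e (d i)) (L2e (d i))" if "i \<in> {1..n}" for i
    using factorization that by blast
  have Dinv: "Dinv i \<in> L2e (d i) \<rightarrow> L2e (d i)"
      "w \<in> L2e (d i) \<Longrightarrow> Di i (Dinv i w) = w" "w \<in> L2e (d i) \<Longrightarrow> Dinv i (Di i w) = w"
    if "i \<in> {1..n}" for i w
    using bij_betw_apply[OF bij_betw_inv_into[OF Dbij[OF that]]]
      bij_betw_inv_into_right[OF Dbij[OF that]] bij_betw_inv_into_left[OF Dbij[OF that]]
    unfolding Dinv_def by blast+
  have Hfac: "Hi i w = Ni i (Dinv i w)" if "i \<in> {1..n}" "w \<in> L2e (d i)" for i w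
    using factorization that by (auto simp: Dinv_def)

  have kappa': "\<forall>i\<in>{1..n}. bij_betw (\<kappa> i) (nbrs E i) {1..deg E i}"
    using kappa by (simp add: d_def)
  have P_map: "P v \<in> L2e p" "v \<in> L2e p \<Longrightarrow> P (P v) = v" "energy_bounded p p P" for v
    using perm_matrix_map[OF graph(1) kappa'] by (simp_all add: P_def p_def m_def)
  have TH_direct: "TH v = direct_sum n d d (\<lambda>i. ones (d i) 1 \<circ> Hi i) v" for v
    unfolding TH_def T_def H_def comp_apply[of "direct_sum _ _ _ _"]
    by (rule direct_sum_comp) (use maps in auto)
  have TH_map: "TH v \<in> L2e p" for v
    unfolding TH_direct p by (rule direct_sum_in_L2e)
  note PK = nominal_inverse[OF nominal[folded p_def] P_map(1,2) TH_map]
  have Q: "u \<in> L2e p \<Longrightarrow> Q u \<in> L2e p" "u \<in> L2e p \<Longrightarrow> (P - TH) (Q u) = u"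
      "y \<in> L2e p \<Longrightarrow> Q ((P - TH) y) = y" for u y
    using bij_betw_apply[OF bij_betw_inv_into[OF PK(1)]]
      bij_betw_inv_into_right[OF PK(1)] bij_betw_inv_into_left[OF PK(1)]
    unfolding Q_def p_def[symmetric] by blast+
  have Q_bdd: "energy_bounded p p Q"
    using PK(2) by (simp add: Q_def p_def)

  have D_map: "D v \<in> L2e p" for v
    unfolding D_def p by (rule direct_sum_in_L2e)
  have D_inv: "D (direct_sum n d d Dinv y) = y" if "y \<in> L2e p" for y
    unfolding D_def by (subst direct_sum_comp) (use that Dinv in \<open>auto simp: p intro!: direct_sum_id\<close>)
  have inv_D: "direct_sum n d d Dinv (D z) = z" if "z \<in> L2e p" for z
    unfolding D_def by (subst direct_sum_comp) (use that Dinv maps in \<open>auto simp: p intro!: direct_sum_id\<close>)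
  \<comment> \<open>In each block the denominator cancels: \<open>Hi i\<close> after
    \<open>Di i\<close> is \<open>Ni i\<close>.\<close>
  have TH_D: "TH (D z) = direct_sum n d d (\<lambda>i. ones (d i) 1 \<circ> Ni i) z" for z
    unfolding TH_direct D_def
    by (subst direct_sum_comp) (use maps Hfac Dinv in \<open>auto intro!: direct_sum_cong simp: block_in_L2e Pi_iff\<close>)
  have M: "M z = (P - TH) (D z)" for z
    by (simp add: M_def TH_D D_def[symmetric])
  have MR: "u \<in> L2e p \<Longrightarrow> M (R u) = u" and RM: "z \<in> L2e p \<Longrightarrow> R (M z) = z" for u z
    using Q(1,2)[of u] Q(3)[OF D_map, of z] D_inv[of "Q u"] inv_D[of z]
    unfolding M R_def comp_apply by simp_all
  have NR: "N z = G (M z)" if "z \<in> L2e p" for z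
  proof -
    \<comment> \<open>\<open>Q\<close> undoes the factor \<open>P - TH\<close> of \<open>M\<close>;
      the remaining denominators cancel block by block.\<close>
    have "G (M z) = Sd (H (D z))"
      using Q(3)[OF D_map] by (simp add: G_def M)
    also have "H (D z) = direct_sum n d (\<lambda>_. 1) Ni z"
      unfolding H_def D_def
      by (subst direct_sum_comp) (use maps Hfac Dinv in \<open>auto intro!: direct_sum_cong simp: block_in_L2e Pi_iff\<close>)
    also have "Sd \<dots> = N z"
      unfolding Sd_def N_def by (rule direct_sum_comp) (use maps in auto)
    finally show ?thesis by simp
  qed

  have M_bdd: "energy_bounded p p M"
  proof -
    have "energy_bounded p p (direct_sum n d d Di)"
        "energy_bounded p p (direct_sum n d d (\<lambda>i. ones (d i) 1 \<circ> Ni i))"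
      unfolding p
      by (intro energy_bounded_direct_sum energy_bounded_comp[OF energy_bounded_ones]
          stable_system_energy_bounded; use N_D in blast)+
    then show ?thesis
      unfolding M_def by (intro energy_bounded_diff energy_bounded_comp[OF P_map(3)])
  qed
  have R_bdd: "energy_bounded p p R"
  proof -
    \<comment> \<open>These are the blocks of \<open>TH\<close> written through the factorization,
      so the side condition in the blockwise bound becomes finite energy of
      \<open>TH y\<close>.\<close>
    let ?K = "\<lambda>i w. ones (d i) 1 (Ni i (Dinv i w))"
    have "\<exists>C>0. \<forall>y\<in>L2 (d i). ?K i y \<in> L2 (d i) \<longrightarrow> Dinv i y \<in> L2 (d i) \<and>
        energy (d i) (Dinv i y) \<le> C * (energy (d i) y + energy (d i) (?K i y))"
      if i: "i \<in> {1..n}" for i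
    proof -
      obtain U V where UV: "stable_system 1 (d i) U" "stable_system (d i) (d i) V"
          "\<forall>v\<in>L2e (d i). U (Ni i v) + V (Di i v) = v"
        using bspec[OF coprime i] by blast
      show ?thesis
        unfolding Dinv_def
        by (rule coprime_factor_energy_bounded[OF UV(1,2)[THEN stable_system_energy_bounded] UV(3)[rule_format]
              Dbij[OF i] maps(1)[OF i] d_pos[OF i]])
    qed
    then have "\<exists>C>0. \<forall>y\<in>L2 p. direct_sum n d d ?K y \<in> L2 p \<longrightarrow>
        direct_sum n d d Dinv y \<in> L2 p \<and>
        energy p (direct_sum n d d Dinv y) \<le> C * (energy p y + energy p (direct_sum n d d ?K y))"
      unfolding p by (rule direct_sum_energy_bound) (auto simp: ones_apply L2e_def)
    moreover have K_TH: "direct_sum n d d ?K y = TH y" for y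
      unfolding TH_direct by (rule direct_sum_cong) (simp add: Hfac block_in_L2e)
    ultimately obtain C where C: "C > 0" "\<And>y. y \<in> L2 p \<Longrightarrow> TH y \<in> L2 p \<Longrightarrow>
        direct_sum n d d Dinv y \<in> L2 p \<and>
        energy p (direct_sum n d d Dinv y) \<le> C * (energy p y + energy p (TH y))"
      unfolding K_TH by blast
    have "energy_bounded p p id"
      unfolding energy_bounded_def by (intro exI[of _ 1]) simp
    then have "energy_bounded p p ((P \<circ> Q) - id)"
      by (rule energy_bounded_diff[OF energy_bounded_comp[OF P_map(3) Q_bdd]])
    then obtain a where a: "a > 0"
        "\<And>u. u \<in> L2 p \<Longrightarrow> ((P \<circ> Q) - id) u \<in> L2 p \<and> energy p (((P \<circ> Q) - id) u) \<le> a * energy p u"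
      unfolding energy_bounded_def by blast
    obtain b where b: "b > 0" "\<And>u. u \<in> L2 p \<Longrightarrow> Q u \<in> L2 p \<and> energy p (Q u) \<le> b * energy p u"
      using Q_bdd by (auto simp: energy_bounded_def)
    \<comment> \<open>\<open>b\<close> bounds \<open>Q u\<close> and \<open>a\<close> bounds
      \<open>TH (Q u)\<close>, which equals \<open>P (Q u) - u\<close>; \<open>C\<close> then bounds
      the inverse denominators in terms of both.\<close>
    have "R u \<in> L2 p \<and> energy p (R u) \<le> C * (b + a) * energy p u" if u: "u \<in> L2 p" for u
    proof -
      have TH_Q: "TH (Q u) = ((P \<circ> Q) - id) u"
        using Q(2)[OF L2_in_L2e[OF u]] by (simp add: algebra_simps)
      have "energy p (Q u) + energy p (TH (Q u)) \<le> (b + a) * energy p u"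
        unfolding TH_Q using a(2)[OF u] b(2)[OF u] by (simp add: distrib_right)
      then have "C * (energy p (Q u) + energy p (TH (Q u))) \<le> C * (b + a) * energy p u"
        using C(1) by (simp add: mult.assoc)
      moreover have "TH (Q u) \<in> L2 p"
        unfolding TH_Q using a(2)[OF u] by blast
      ultimately show ?thesis
        using C(2)[of "Q u"] b(2)[OF u] by (auto simp: R_def)
    qed
    with C(1) a(1) b(1) show ?thesis
      unfolding energy_bounded_def by (intro exI[of _ "C * (b + a)"]) auto
  qed
  have NG: "N (R u) = G u" if u: "u \<in> L2e p" for u
  proof -
    have "R u \<in> L2e p"
      unfolding R_def comp_apply p by (rule direct_sum_in_L2e)
    then show ?thesis
      using NR MR[OF u] by simp
  qed
  have "(\<exists>\<epsilon>>0. \<forall>u\<in>L2 p. quad_form n p \<Pi>1 \<Pi>2 \<Pi>3 (G u) u \<le> - \<epsilon> * (norm_L2 p u)\<^sup>2)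
     \<longleftrightarrow> (\<exists>\<epsilon>>0. \<forall>z\<in>L2 p. quad_form n p \<Pi>1 \<Pi>2 \<Pi>3 (N z) (M z) \<le> - \<epsilon> * (norm_L2 p z)\<^sup>2)"
    by (rule negativity_reparametrization[OF M_bdd R_bdd,
          where q = "quad_form n p \<Pi>1 \<Pi>2 \<Pi>3" and N = N and G = G])
      (auto intro: MR RM NG L2_in_L2e)
  then show ?thesis by (simp only: p_def)
qed

end
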